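(* Let $$L(\lambda):=\begin{cases}0 & \text{for } 0\le\lambda<1,\\ [\ln\lambda]^2 & \text{for }\lambda\ge 1,\end{cases}$$ and let $A$ be a scalar type spectral operator in a complex Banach space $(X,\|\cdot\|)$ with spectrum $\sigma(A)$. Then $A$ generates a $C_{(e^{n^2})}$-semigroup (a Beurling type Carleman ultradifferentiable $C_0$-semigroup corresponding to the sequence $m_n=e^{n^2}$, $n=0,1,2,\dots$) if and only if for any $b>0$ there is an $a\in\mathbb{R}$ such that $$\operatorname{Re}\lambda\le a-bL(|\operatorname{Im}\lambda|)\quad\text{for all }\lambda\in\sigma(A).$$
   Context: Scalar type spectral operator (in the sense of Dunford): a densely defined closed linear operator $A$ in a complex Banach space $X$ for which there is a spectral measure (resolution of the identity) $E_A(\cdot)$ on the Borel subsets of $\mathbb{C}$, that is, a strongly countably additive Boolean-homomorphic family of bounded projections on $X$ with $E_A(\mathbb{C})=I$ and $E_A(\delta\cap\sigma)=E_A(\delta)E_A(\sigma)$, supported on the spectrum $\sigma(A)$, such that $A=\int_{\sigma(A)}\lambda\,dE_A(\lambda)$. Here, for a Borel measurable $F:\sigma(A)\to\mathbb{C}$, the operator $F(A)=\int_{\sigma(A)}F(\lambda)\,dE_A(\lambda)$ is defined by $F(A)f:=\lim_{n\to\infty}F_n(A)f$ on the domain of all $f\in X$ for which this limit exists, where $F_n:=F\cdot\chi_{\{\lambda\in\sigma(A):|F(\lambda)|\le n\}}$ and $F_n(A)=\int_{\sigma(A)}F_n\,dE_A$ is the bounded operator given by the integral of a bounded Borel function with respect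 to $E_A$. $C_{(e^{n^2})}$-semigroup: a $C_0$-semigroup (strongly continuous one-parameter semigroup of bounded linear operators) $\{S(t)\,|\,t\ge0\}$ on $X$ such that for each $f\in X$ the orbit $g=S(\cdot)f$ is strongly infinitely differentiable on $(0,\infty)$ and for every $[a,b]\subseteq(0,\infty)$ and every $\alpha>0$ there is $c>0$ with $\max_{a\le t\le b}\|g^{(n)}(t)\|\le c\,\alpha^n e^{n^2}$ for all $n=0,1,2,\dots$. "$A$ generates a $C_{(e^{n^2})}$-semigroup" means that $A$ is the infinitesimal generator of a $C_0$-semigroup that is a $C_{(e^{n^2})}$-semigroup. *)

theory Defs
  imports "HOL-Analysis.Analysis"
begin

class complex_banach = banach +
  fixes scaleC :: "complex \<Rightarrow> 'a \<Rightarrow> 'a"  (infixr \<open>*\<^sub>C\<close> 75)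
  assumes scaleC_add_right: "c *\<^sub>C (x + y) = c *\<^sub>C x + c *\<^sub>C y"
    and scaleC_add_left: "(c + d) *\<^sub>C x = c *\<^sub>C x + d *\<^sub>C x"
    and scaleC_scaleC: "c *\<^sub>C (d *\<^sub>C x) = (c * d) *\<^sub>C x"
    and scaleC_of_real: "complex_of_real r *\<^sub>C x = r *\<^sub>R x"
    and norm_scaleC: "norm (c *\<^sub>C x) = cmod c * norm x"

definition bounded_clinear :: "('a::complex_banach \<Rightarrow> 'a) \<Rightarrow> bool" where
  "bounded_clinear T \<longleftrightarrow> bounded_linear T \<and> (\<forall>c x. T (c *\<^sub>C x) = c *\<^sub>C T x)"

text \<open>A possibly unbounded operator is represented by its graph, so that equality of operators
  includes equality of their domains; the domain of \<open>A\<close> is \<open>Domain A\<close>.\<close>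

type_synonym 'a operator = "('a \<times> 'a) set"

definition linear_operator :: "'a::complex_banach operator \<Rightarrow> bool" where
  "linear_operator A \<longleftrightarrow> single_valued A \<and> (0, 0) \<in> A \<and>
     (\<forall>x y x' y'. (x, y) \<in> A \<and> (x', y') \<in> A \<longrightarrow> (x + x', y + y') \<in> A) \<and>
     (\<forall>c x y. (x, y) \<in> A \<longrightarrow> (c *\<^sub>C x, c *\<^sub>C y) \<in> A)"

definition densely_defined :: "'a::complex_banach operator \<Rightarrow> bool" where
  "densely_defined A \<longleftrightarrow> closure (Domain A) = UNIV"

definition closed_operator :: "'a::complex_banach operator \<Rightarrow> bool" where
  "closed_operator A \<longleftrightarrow> closed A"

text \<open>The set in braces is the graph of the inverse of \<open>zI - A\<close>; it is required to be the graph of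
  an everywhere defined bounded operator.\<close>

definition resolvent_set :: "'a::complex_banach operator \<Rightarrow> complex set" where
  "resolvent_set A =
     {z. \<exists>R. bounded_clinear R \<and> {(z *\<^sub>C x - y, x) | x y. (x, y) \<in> A} = {(w, R w) | w. True}}"

definition spectrum :: "'a::complex_banach operator \<Rightarrow> complex set" where
  "spectrum A = - resolvent_set A"

text \<open>Only the values of \<open>E\<close> on Borel sets matter. That each \<open>E \<delta>\<close> is a projection is the case
  \<open>\<sigma> = \<delta>\<close> of the multiplicativity condition.\<close>

definition spectral_measure :: "(complex set \<Rightarrow> 'a::complex_banach \<Rightarrow> 'a) \<Rightarrow> bool" where
  "spectral_measure E \<longleftrightarrow>
     (\<forall>\<delta>\<in>sets borel. bounded_clinear (E \<delta>)) \<and>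
     E UNIV = id \<and>
     (\<forall>\<delta>\<in>sets borel. \<forall>\<sigma>\<in>sets borel. E (\<delta> \<inter> \<sigma>) = E \<delta> \<circ> E \<sigma>) \<and>
     (\<forall>\<delta>\<in>sets borel. \<forall>f. E (- \<delta>) f = f - E \<delta> f) \<and>
     (\<forall>\<Delta>::nat \<Rightarrow> complex set. range \<Delta> \<subseteq> sets borel \<and> disjoint_family \<Delta> \<longrightarrow>
        (\<forall>f. (\<lambda>n. E (\<Delta> n) f) sums E (\<Union>n. \<Delta> n) f))"

definition simple_spectral_integral ::
    "(complex set \<Rightarrow> 'a::complex_banach \<Rightarrow> 'a) \<Rightarrow> (complex \<Rightarrow> complex) \<Rightarrow> 'a \<Rightarrow> 'a" where
  "simple_spectral_integral E s f = (\<Sum>c\<in>range s. c *\<^sub>C E (s -` {c}) f)"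

text \<open>The integral of a bounded Borel function is the common limit of the integrals of all
  sequences of simple functions converging to it uniformly. For a spectral measure these converge
  in operator norm, so taking the limit pointwise in \<open>f\<close> gives the same operator.\<close>

definition bounded_spectral_integral ::
    "(complex set \<Rightarrow> 'a::complex_banach \<Rightarrow> 'a) \<Rightarrow> (complex \<Rightarrow> complex) \<Rightarrow> 'a \<Rightarrow> 'a" where
  "bounded_spectral_integral E F f =
     (THE g. \<forall>s. (\<forall>n. simple_function borel (s n)) \<and> uniform_limit UNIV s F sequentially \<longrightarrow>
        (\<lambda>n. simple_spectral_integral E (s n) f) \<longlonglongrightarrow> g)"

definition truncation :: "complex set \<Rightarrow> (complex \<Rightarrow> complex) \<Rightarrow> nat \<Rightarrow> complex \<Rightarrow> complex" where
  "truncation K F n = (\<lambda>z. F z * indicator {w \<in> K. cmod (F w) \<le> real n} z)"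

definition spectral_integral ::
    "(complex set \<Rightarrow> 'a::complex_banach \<Rightarrow> 'a) \<Rightarrow> complex set \<Rightarrow> (complex \<Rightarrow> complex) \<Rightarrow> 'a operator"
  where
  "spectral_integral E K F =
     {(f, g). (\<lambda>n. bounded_spectral_integral E (truncation K F n) f) \<longlonglongrightarrow> g}"

text \<open>The spectrum of a closed operator is closed, hence Borel, so \<open>E (spectrum A) = id\<close> says that
  \<open>E\<close> vanishes on the Borel sets disjoint from the spectrum.\<close>

definition scalar_type_spectral :: "'a::complex_banach operator \<Rightarrow> bool" where
  "scalar_type_spectral A \<longleftrightarrow>
     linear_operator A \<and> densely_defined A \<and> closed_operator A \<and>
     (\<exists>E. spectral_measure E \<and> E (spectrum A) = id \<and>
        A = spectral_integral E (spectrum A) (\<lambda>z. z))"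

text \<open>A semigroup is a function on all reals of which only the values at nonnegative times
  matter.\<close>

definition C0_semigroup :: "(real \<Rightarrow> 'a::complex_banach \<Rightarrow> 'a) \<Rightarrow> bool" where
  "C0_semigroup S \<longleftrightarrow>
     (\<forall>t\<ge>0. bounded_clinear (S t)) \<and>
     S 0 = id \<and>
     (\<forall>s\<ge>0. \<forall>t\<ge>0. S (s + t) = S s \<circ> S t) \<and>
     (\<forall>f. continuous_on {0..} (\<lambda>t. S t f))"

definition generator :: "(real \<Rightarrow> 'a::complex_banach \<Rightarrow> 'a) \<Rightarrow> 'a operator" where
  "generator S = {(f, g). ((\<lambda>t. (S t f - f) /\<^sub>R t) \<longlongrightarrow> g) (at_right 0)}"

definition nth_derivative :: "nat \<Rightarrow> (real \<Rightarrow> 'a::real_normed_vector) \<Rightarrow> real \<Rightarrow> 'a" where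
  "nth_derivative n = (\<lambda>h t. vector_derivative h (at t)) ^^ n"

definition infinitely_differentiable_on ::
    "(real \<Rightarrow> 'a::real_normed_vector) \<Rightarrow> real set \<Rightarrow> bool" where
  "infinitely_differentiable_on g I \<longleftrightarrow>
     (\<forall>n. \<forall>t\<in>I. nth_derivative n g differentiable (at t))"

definition beurling_carleman_on ::
    "(nat \<Rightarrow> real) \<Rightarrow> (real \<Rightarrow> 'a::real_normed_vector) \<Rightarrow> real set \<Rightarrow> bool" where
  "beurling_carleman_on m g I \<longleftrightarrow> infinitely_differentiable_on g I \<and>
     (\<forall>a b. a \<le> b \<and> {a..b} \<subseteq> I \<longrightarrow>
        (\<forall>\<alpha>>0. \<exists>c>0. \<forall>n. \<forall>t\<in>{a..b}. norm (nth_derivative n g t) \<le> c * \<alpha> ^ n * m n))"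

definition generates_beurling_carleman_semigroup ::
    "(nat \<Rightarrow> real) \<Rightarrow> 'a::complex_banach operator \<Rightarrow> bool" where
  "generates_beurling_carleman_semigroup m A \<longleftrightarrow>
     (\<exists>S. C0_semigroup S \<and> generator S = A \<and>
        (\<forall>f. beurling_carleman_on m (\<lambda>t. S t f) {0<..}))"

text \<open>Used only at nonnegative arguments.\<close>

definition L :: "real \<Rightarrow> real" where
  "L x = (if x < 1 then 0 else (ln x)\<^sup>2)"

end

theory Submission
  imports Defs
begin

text \<open>
  Write \<open>\<sigma>\<close> for the spectrum of \<open>A\<close> and \<open>\<Phi> F\<close> for the integral of \<open>F\<close> against the spectral measure
  \<open>E\<close>.  Both implications go through the scalar condition
  \<open>\<bar>z\<bar>\<^sup>n e\<^bsup>t Re z\<^esup> \<le> C \<alpha>\<^sup>n e\<^bsup>n\<^sup>2\<^esup>\<close> for all \<open>z \<in> \<sigma>\<close> and all \<open>n\<close>, where \<open>C\<close> depends on \<open>t > 0\<close> and \<open>\<alpha> > 0\<close>.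
  Imposed for every \<open>t > 0\<close>, it is the logarithmic bound on the real parts, by Legendre duality: for
  \<open>\<bar>z\<bar> \<ge> 1\<close> the minimum over \<open>n\<close> of \<open>n\<^sup>2 - n ln \<bar>z\<bar>\<close> is \<open>- (ln \<bar>z\<bar>)\<^sup>2 / 4\<close> up to a bounded error, so the
  condition says \<open>t Re z \<le> const - (ln \<bar>z\<bar>)\<^sup>2 / 4\<close>, and small \<open>t\<close> corresponds to large \<open>b\<close>.  The factor
  \<open>\<alpha>\<^sup>n\<close> only shifts \<open>ln \<bar>z\<bar>\<close> by a constant.  In the region where the bound is not trivial,
  \<open>ln \<bar>z\<bar>\<close> may be replaced by \<open>ln \<bar>Im z\<bar>\<close>, since a point with dominant real part satisfies
  \<open>Re z \<le> - \<bar>z\<bar> / 2\<close> or is bounded.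

  The link to semigroups is a functional calculus.  A spectral measure is uniformly bounded
  (\<open>spectral_measure_bounded\<close>), so \<open>\<Phi>\<close> is a bounded multiplicative map on bounded Borel functions,
  and it has a dominated convergence theorem (\<open>bounded_integral_dominated_LIMSEQ\<close>) from which strong
  continuity, differentiation under the integral and the identification of generators follow.
  The unbounded operator \<open>A\<close> is controlled by its bounded pieces: \<open>(f, g) \<in> A\<close> iff
  \<open>E K\<^sub>n g = \<Phi> (z 1\<^bsub>K\<^sub>n\<^esub>) f\<close> for all \<open>n\<close>, where \<open>K\<^sub>n = {z \<in> \<sigma>. \<bar>z\<bar> \<le> n}\<close>
  (\<open>mem_operator_iff\<close>).

  If the bound on the spectrum holds, \<open>S t = \<Phi> (e\<^sup>t\<^sup>z 1\<^sub>\<sigma>)\<close> is a \<open>C\<^sub>0\<close>-semigroup generated by \<open>A\<close>,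
  its orbits have derivatives \<open>\<Phi> (z\<^sup>n e\<^sup>t\<^sup>z 1\<^sub>\<sigma>) f\<close>, and the scalar condition bounds them.
  Conversely, let \<open>A\<close> generate \<open>S\<close>.  Differentiable orbits solve the abstract Cauchy problem, hence
  \<open>E K\<^sub>m (S t f) = \<Phi> (e\<^sup>t\<^sup>z 1\<^bsub>K\<^sub>m\<^esub>) f\<close>, and the same for derivatives.  The estimates hold for each
  orbit separately; the uniform boundedness principle makes them uniform in \<open>f\<close>, \<open>n\<close> and \<open>m\<close>, and
  vectors in the range of \<open>E\<close> of a small ball around \<open>z \<in> \<sigma>\<close>, which are approximate
  eigenvectors, turn them into the scalar condition at \<open>z\<close> (\<open>spectrum_growth\<close>).
\<close>

section \<open>Complex scalar multiplication and uniform boundedness\<close>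

lemma bounded_bilinear_scaleC:
  "bounded_bilinear (scaleC :: complex \<Rightarrow> 'a::complex_banach \<Rightarrow> 'a)"
proof
  fix a a' :: complex and b b' :: 'a and r :: real
  show "(a + a') *\<^sub>C b = a *\<^sub>C b + a' *\<^sub>C b" by (rule scaleC_add_left)
  show "a *\<^sub>C (b + b') = a *\<^sub>C b + a *\<^sub>C b'" by (rule scaleC_add_right)
  show "(r *\<^sub>R a) *\<^sub>C b = r *\<^sub>R (a *\<^sub>C b)"
    by (metis scaleC_of_real scaleC_scaleC scaleR_conv_of_real)
  show "a *\<^sub>C (r *\<^sub>R b) = r *\<^sub>R (a *\<^sub>C b)"
    by (metis mult.commute scaleC_of_real scaleC_scaleC)
  show "\<exists>K. \<forall>a (b::'a). norm (a *\<^sub>C b) \<le> norm a * norm b * K"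
    by (intro exI[of _ 1]) (simp add: norm_scaleC)
qed

interpretation scaleC: bounded_bilinear "scaleC :: complex \<Rightarrow> 'a::complex_banach \<Rightarrow> 'a"
  by (rule bounded_bilinear_scaleC)

lemma scaleC_one [simp]: "1 *\<^sub>C x = (x::'a::complex_banach)"
  using scaleC_of_real[of 1 x] by simp

lemma bounded_clinearI:
  assumes "\<And>x y. T (x + y) = T x + T y" "\<And>c x. T (c *\<^sub>C x) = c *\<^sub>C T x"
    and "\<And>x. norm (T x) \<le> K * norm x"
  shows "bounded_clinear T"
proof -
  have "T (r *\<^sub>R x) = r *\<^sub>R T x" for r x
    using assms(2)[of "complex_of_real r"] by (simp add: scaleC_of_real)
  then show ?thesis
    unfolding bounded_clinear_def
    using assms by (auto intro!: bounded_linear_intro[where K = K] simp: mult.commute)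
qed

text \<open>By Baire, one of the closed sets of points where the whole family is bounded by \<open>k\<close>
  contains a ball; a difference of two points of the ball reaches every direction.\<close>

lemma uniform_boundedness:
  fixes T :: "'i \<Rightarrow> 'a::banach \<Rightarrow> 'b::real_normed_vector"
  assumes lin: "\<And>i. i \<in> I \<Longrightarrow> bounded_linear (T i)"
    and bdd: "\<And>x. \<exists>c. \<forall>i\<in>I. norm (T i x) \<le> c"
  obtains C where "\<And>i x. i \<in> I \<Longrightarrow> norm (T i x) \<le> C * norm x" "0 \<le> C"
proof -
  define V where "V k = {x. \<forall>i\<in>I. norm (T i x) \<le> real k}" for k :: nat
  have clV: "closed (V k)" for k
  proof -
    have "V k = (\<Inter>i\<in>I. {x. norm (T i x) \<le> real k})"
      by (auto simp: V_def)
    moreover have "closed {x. norm (T i x) \<le> real k}" if "i \<in> I" for i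
      using lin[OF that] by (intro closed_Collect_le continuous_intros linear_continuous_on)
    ultimately show ?thesis by auto
  qed
  have cover: "(\<Union>k. V k) = UNIV"
  proof -
    have "\<exists>k. x \<in> V k" for x
    proof -
      obtain c where c: "\<forall>i\<in>I. norm (T i x) \<le> c" using bdd by blast
      obtain k :: nat where "c \<le> real k" using real_arch_simple by blast
      then have "x \<in> V k" using c by (auto simp: V_def intro: order_trans)
      then show ?thesis ..
    qed
    then show ?thesis by auto
  qed
  have "\<exists>k. interior (V k) \<noteq> {}"
  proof (rule ccontr)
    assume "\<not> ?thesis"
    then have "interior (\<Union>(range V)) = {}"
      using Baire_category_alt[of "euclidean :: 'a topology" "range V"] clV
      by (auto simp: completely_metrizable_space_euclidean)
    then show False using cover by simp
  qed
  then obtain k x0 where "x0 \<in> interior (V k)" by blast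
  then obtain r where r: "r > 0" "cball x0 r \<subseteq> V k"
    by (meson mem_interior_cball)
  have bound: "norm (T i x) \<le> (2 * real k / r) * norm x" if i: "i \<in> I" for i x
  proof (cases "x = 0")
    case True
    then show ?thesis using lin[OF i] by (simp add: linear_0 bounded_linear.linear)
  next
    case False
    interpret bounded_linear "T i" by (rule lin[OF i])
    define y where "y = (r / norm x) *\<^sub>R x"
    have "x0 + y \<in> cball x0 r" "x0 \<in> cball x0 r"
      using r False by (auto simp: y_def dist_norm)
    then have "norm (T i (x0 + y)) \<le> k" "norm (T i x0) \<le> k"
      using r(2) i unfolding V_def by blast+
    then have "norm (T i y) \<le> 2 * real k"
      using norm_triangle_ineq4[of "T i (x0 + y)" "T i x0"] by (simp add: add)
    then have "(r / norm x) * norm (T i x) \<le> 2 * real k"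
      using r by (simp add: y_def scaleR)
    then show ?thesis using r False by (simp add: field_simps)
  qed
  show ?thesis by (rule that[OF bound]) (use r in auto)
qed

section \<open>Closedness of the spectrum\<close>

text \<open>With \<open>R = (z - A)\<^sup>-\<^sup>1\<close> and \<open>c = w - z\<close> the factorisation \<open>w - A = (1 + c R) (z - A)\<close> reduces
  the claim to inverting \<open>1 + c R\<close> when \<open>c R\<close> has norm at most \<open>1/2\<close>.  The inverse \<open>Q\<close> is obtained
  from the Banach fixed point theorem for \<open>u \<mapsto> v - c R u\<close>.\<close>

lemma open_resolvent_set:
  fixes A :: "'a::complex_banach operator"
  shows "open (resolvent_set A)"
  unfolding open_dist
proof (intro ballI)
  fix z assume "z \<in> resolvent_set A"
  then obtain R where R: "bounded_clinear R"
    and gr: "{(z *\<^sub>C x - y, x) | x y. (x, y) \<in> A} = {(w, R w) | w. True}"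
    unfolding resolvent_set_def by auto
  interpret R: bounded_linear R using R by (simp add: bounded_clinear_def)
  have RC: "R (c *\<^sub>C x) = c *\<^sub>C R x" for c x using R by (simp add: bounded_clinear_def)
  obtain k where k: "k > 0" "\<And>x. norm (R x) \<le> norm x * k" using R.pos_bounded by blast
  show "\<exists>e>0. \<forall>w. dist w z < e \<longrightarrow> w \<in> resolvent_set A"
  proof (intro exI[of _ "1 / (2 * k)"] conjI allI impI)
    show "0 < 1 / (2 * k)" using k by simp
    fix w assume "dist w z < 1 / (2 * k)"
    then have ck: "norm (w - z) * k \<le> 1 / 2" using k by (simp add: dist_norm field_simps)
    define c where "c = w - z"
    have cR: "norm (c *\<^sub>C R x) \<le> norm x / 2" for x
    proof -
      have "norm (c *\<^sub>C R x) \<le> norm c * (norm x * k)"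
        using k by (simp add: norm_scaleC mult_left_mono)
      also have "\<dots> \<le> norm x / 2" using mult_left_mono[OF ck norm_ge_zero[of x]]
        by (simp add: c_def algebra_simps)
      finally show ?thesis .
    qed
    have "\<exists>!u. v - c *\<^sub>C R u = u" for v
    proof (rule banach_fix_type[of "1/2"])
      show "\<forall>x y. dist (v - c *\<^sub>C R x) (v - c *\<^sub>C R y) \<le> 1 / 2 * dist x y"
      proof (intro allI)
        fix x y
        have "(v - c *\<^sub>C R x) - (v - c *\<^sub>C R y) = c *\<^sub>C R (y - x)"
          by (simp add: R.diff scaleC.diff_right)
        then show "dist (v - c *\<^sub>C R x) (v - c *\<^sub>C R y) \<le> 1 / 2 * dist x y"
          using cR[of "y - x"] by (simp add: dist_norm norm_minus_commute)
      qed
    qed auto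
    then obtain Q where Q: "\<And>v. v - c *\<^sub>C R (Q v) = Q v"
      and Qu: "\<And>u v. v - c *\<^sub>C R u = u \<Longrightarrow> u = Q v" by metis
    have Qadd: "Q (x + y) = Q x + Q y" for x y
      by (rule Qu[symmetric]) (use Q[of x] Q[of y] in \<open>simp add: R.add scaleC_add_right algebra_simps\<close>)
    have QC: "Q (a *\<^sub>C x) = a *\<^sub>C Q x" for a x
    proof (rule Qu[symmetric])
      have "a *\<^sub>C x - c *\<^sub>C R (a *\<^sub>C Q x) = a *\<^sub>C (x - c *\<^sub>C R (Q x))"
        by (simp add: RC scaleC_scaleC scaleC.diff_right mult.commute)
      then show "a *\<^sub>C x - c *\<^sub>C R (a *\<^sub>C Q x) = a *\<^sub>C Q x" using Q[of x] by simp
    qed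
    have Qn: "norm (Q x) \<le> 2 * norm x" for x
      using norm_triangle_ineq4[of x "c *\<^sub>C R (Q x)"] cR[of "Q x"] Q[of x] by simp
    have "bounded_clinear (\<lambda>v. R (Q v))"
    proof (rule bounded_clinearI)
      fix x y a
      show "R (Q (x + y)) = R (Q x) + R (Q y)" by (simp add: Qadd R.add)
      show "R (Q (a *\<^sub>C x)) = a *\<^sub>C R (Q x)" by (simp add: QC RC)
      show "norm (R (Q x)) \<le> (2 * k) * norm x"
        using order_trans[OF k(2)[of "Q x"] mult_right_mono[OF Qn[of x], of k]] k(1) by (simp add: mult_ac)
    qed
    moreover have "{(w *\<^sub>C x - y, x) | x y. (x, y) \<in> A} = {(v, R (Q v)) | v. True}" (is "?l = ?r")
    proof
      show "?l \<subseteq> ?r"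
      proof clarify
        fix x y assume "(x, y) \<in> A"
        then have "(z *\<^sub>C x - y, x) \<in> {(w, R w) | w. True}" using gr by blast
        then have x: "x = R (z *\<^sub>C x - y)" by auto
        have "Q (w *\<^sub>C x - y) = z *\<^sub>C x - y"
          by (rule Qu[symmetric]) (use x in \<open>simp add: c_def scaleC.diff_left\<close>)
        then show "\<exists>v. (w *\<^sub>C x - y, x) = (v, R (Q v)) \<and> True" using x by auto
      qed
      show "?r \<subseteq> ?l"
      proof clarify
        fix v
        have "(Q v, R (Q v)) \<in> {(z *\<^sub>C x - y, x) | x y. (x, y) \<in> A}" using gr by blast
        then obtain y where y: "Q v = z *\<^sub>C R (Q v) - y" "(R (Q v), y) \<in> A" by auto
        have "v = Q v + c *\<^sub>C R (Q v)" by (metis Q diff_add_cancel)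
        also have "\<dots> = (z *\<^sub>C R (Q v) - y) + c *\<^sub>C R (Q v)" by (metis y(1))
        also have "\<dots> = w *\<^sub>C R (Q v) - y" by (simp add: c_def scaleC.diff_left)
        finally have "v = w *\<^sub>C R (Q v) - y" .
        then show "\<exists>x y. (v, R (Q v)) = (w *\<^sub>C x - y, x) \<and> (x, y) \<in> A" using y(2) by blast
      qed
    qed
    ultimately show "w \<in> resolvent_set A" unfolding resolvent_set_def by blast
  qed
qed

lemma closed_spectrum: "closed (spectrum A)"
  unfolding spectrum_def by (intro closed_Compl open_resolvent_set)

section \<open>Boundedness of spectral measures\<close>

lemma spectral_measure_Diff:
  assumes "spectral_measure E" "\<delta> \<in> sets borel" "\<sigma> \<in> sets borel" "\<delta> \<subseteq> \<sigma>"
  shows "E (\<sigma> - \<delta>) f = E \<sigma> f - E \<delta> f"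
proof -
  have "E (\<sigma> \<inter> - \<delta>) = E \<sigma> \<circ> E (- \<delta>)" "E (\<sigma> \<inter> \<delta>) = E \<sigma> \<circ> E \<delta>"
    "E (- \<delta>) f = f - E \<delta> f" "bounded_clinear (E \<sigma>)"
    using assms by (auto simp: spectral_measure_def)
  moreover have "\<sigma> - \<delta> = \<sigma> \<inter> - \<delta>" "\<sigma> \<inter> \<delta> = \<delta>" using assms(4) by auto
  ultimately show ?thesis
    by (simp add: bounded_clinear_def fun_eq_iff linear_diff bounded_linear.linear)
qed

text \<open>A set on which the vector measure is unbounded splits into two parts of which both have
  measure of norm at least 1 and one is again unbounded.  Peeling off the other part infinitely
  often gives disjoint sets whose measures do not tend to 0, against countable additivity.\<close>

lemma spectral_measure_orbit_bounded:
  assumes E: "spectral_measure E"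
  shows "\<exists>c. \<forall>\<delta>\<in>sets borel. norm (E \<delta> f) \<le> c"
proof (rule ccontr)
  define unb where "unb S \<longleftrightarrow> (\<forall>c. \<exists>\<delta>\<in>sets borel. \<delta> \<subseteq> S \<and> norm (E \<delta> f) > c)" for S
  assume "\<not> ?thesis"
  then have unb0: "unb UNIV" by (force simp: unb_def not_le)
  have step: "\<exists>S'. S' \<in> sets borel \<and> unb S' \<and> S' \<subseteq> S \<and> 1 \<le> norm (E (S - S') f)"
    if S: "S \<in> sets borel" "unb S" for S
  proof -
    obtain B where B: "B \<in> sets borel" "B \<subseteq> S" "norm (E B f) > 1 + norm (E S f)"
      using S(2) unfolding unb_def by blast
    have D: "E (S - B) f = E S f - E B f"
      using spectral_measure_Diff[OF E B(1) S(1) B(2)] .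
    have nD: "1 \<le> norm (E (S - B) f)"
      using norm_triangle_ineq3[of "E S f" "E B f"] B(3) unfolding D by linarith
    have "unb B \<or> unb (S - B)"
    proof (rule ccontr)
      assume "\<not> (unb B \<or> unb (S - B))"
      then obtain c1 c2 where
        c1: "\<And>\<delta>. \<delta> \<in> sets borel \<Longrightarrow> \<delta> \<subseteq> B \<Longrightarrow> norm (E \<delta> f) \<le> c1" and
        c2: "\<And>\<delta>. \<delta> \<in> sets borel \<Longrightarrow> \<delta> \<subseteq> S - B \<Longrightarrow> norm (E \<delta> f) \<le> c2"
        unfolding unb_def by (metis not_less)
      obtain \<delta> where \<delta>: "\<delta> \<in> sets borel" "\<delta> \<subseteq> S" "norm (E \<delta> f) > c1 + c2"
        using S(2) unfolding unb_def by blast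
      have "E (\<delta> - \<delta> \<inter> B) f = E \<delta> f - E (\<delta> \<inter> B) f"
        using \<delta> B by (intro spectral_measure_Diff[OF E]) auto
      moreover have "norm (E (\<delta> \<inter> B) f) \<le> c1" using \<delta> B by (intro c1) auto
      moreover have "norm (E (\<delta> - \<delta> \<inter> B) f) \<le> c2" using \<delta> B by (intro c2) auto
      ultimately show False
        using \<delta>(3) norm_triangle_ineq2[of "E \<delta> f" "E (\<delta> \<inter> B) f"] by simp
    qed
    then show ?thesis
    proof
      assume "unb B"
      then show ?thesis using B nD by blast
    next
      assume "unb (S - B)"
      moreover have "S - (S - B) = B" using B by auto
      moreover have "1 \<le> norm (E B f)" using B(3) norm_ge_zero[of "E S f"] by linarith
      ultimately show ?thesis using B S
        by (intro exI[of _ "S - B"]) auto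
    qed
  qed
  define P where "P S S' \<longleftrightarrow> S' \<in> sets borel \<and> unb S' \<and> S' \<subseteq> S \<and> 1 \<le> norm (E (S - S') f)" for S S'
  have "\<exists>S. \<forall>n::nat. (S n \<in> sets borel \<and> unb (S n)) \<and> P (S n) (S (Suc n))"
    by (rule dependent_nat_choice) (use unb0 step in \<open>auto simp: P_def intro: exI[of _ UNIV]\<close>)
  then obtain S where S: "\<And>n. S n \<in> sets borel" "\<And>n. S (Suc n) \<subseteq> S n"
      "\<And>n. 1 \<le> norm (E (S n - S (Suc n)) f)"
    unfolding P_def by blast
  have dec: "S n \<subseteq> S m" if "m \<le> n" for m n
    using that S(2) by (rule lift_Suc_antimono_le[rotated])
  have "disjoint_family (\<lambda>n. S n - S (Suc n))"
    unfolding disjoint_family_on_def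
  proof (intro ballI impI)
    fix m n :: nat assume "m \<noteq> n"
    then have "Suc m \<le> n \<or> Suc n \<le> m" by linarith
    then show "(S m - S (Suc m)) \<inter> (S n - S (Suc n)) = {}" using dec by blast
  qed
  moreover have "range (\<lambda>n. S n - S (Suc n)) \<subseteq> sets borel" using S(1) by auto
  ultimately have "(\<lambda>n. E (S n - S (Suc n)) f) sums E (\<Union>n. S n - S (Suc n)) f"
    using E unfolding spectral_measure_def by blast
  then have "(\<lambda>n. E (S n - S (Suc n)) f) \<longlonglongrightarrow> 0"
    by (intro summable_LIMSEQ_zero) (simp add: sums_iff)
  then have "\<forall>\<^sub>F n in sequentially. dist (E (S n - S (Suc n)) f) 0 < 1"
    by (rule tendstoD) simp
  then have "\<forall>\<^sub>F n in sequentially. norm (E (S n - S (Suc n)) f) < 1"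
    by simp
  then obtain n where "norm (E (S n - S (Suc n)) f) < 1"
    by (auto simp: eventually_sequentially)
  then show False using S(3)[of n] by simp
qed

lemma spectral_measure_bounded:
  assumes E: "spectral_measure (E :: complex set \<Rightarrow> 'a::complex_banach \<Rightarrow> 'a)"
  obtains M where "0 \<le> M" "\<And>\<delta> f. \<delta> \<in> sets borel \<Longrightarrow> norm (E \<delta> f) \<le> M * norm f"
proof -
  have "\<And>\<delta>. \<delta> \<in> sets borel \<Longrightarrow> bounded_linear (E \<delta>)"
    using E by (simp add: spectral_measure_def bounded_clinear_def)
  then show ?thesis
    by (rule uniform_boundedness[of "sets borel" E])
      (use spectral_measure_orbit_bounded[OF E] that in \<open>auto\<close>)
qed

section \<open>Elementary estimates and derivatives\<close>

text \<open>The norm is convex in each coefficient, so over a cube of coefficients its maximum is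
  attained at a vertex.  For the values of a spectral measure on disjoint sets, the sum at a vertex
  is again a value of the measure.\<close>

lemma norm_convex_combination_le:
  fixes x :: "'i \<Rightarrow> 'a::real_normed_vector"
  assumes "finite I" "\<And>i. i \<in> I \<Longrightarrow> 0 \<le> c i \<and> c i \<le> 1"
    and "\<And>J. J \<subseteq> I \<Longrightarrow> norm (v + (\<Sum>j\<in>J. x j)) \<le> B"
  shows "norm (v + (\<Sum>i\<in>I. c i *\<^sub>R x i)) \<le> B"
  using assms
proof (induction I arbitrary: v rule: finite_induct)
  case empty
  then show ?case by force
next
  case (insert k I)
  have 0: "norm (v + (\<Sum>i\<in>I. c i *\<^sub>R x i)) \<le> B"
    using insert.prems by (intro insert.IH) (auto intro: subset_insertI2)
  have 1: "norm (v + x k + (\<Sum>i\<in>I. c i *\<^sub>R x i)) \<le> B"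
  proof (rule insert.IH)
    fix J assume J: "J \<subseteq> I"
    then have "k \<notin> J" "finite J" using insert.hyps by (auto dest: finite_subset)
    then show "norm (v + x k + (\<Sum>j\<in>J. x j)) \<le> B"
      using insert.prems(2)[of "insert k J"] J by (auto simp: add.assoc)
  qed (use insert.prems in auto)
  have c: "0 \<le> c k" "c k \<le> 1" using insert.prems by auto
  have "v + (\<Sum>i\<in>insert k I. c i *\<^sub>R x i) =
      (1 - c k) *\<^sub>R (v + (\<Sum>i\<in>I. c i *\<^sub>R x i)) + c k *\<^sub>R (v + x k + (\<Sum>i\<in>I. c i *\<^sub>R x i))"
    using insert.hyps by (simp add: algebra_simps)
  also have "norm \<dots> \<le> (1 - c k) * B + c k * B"
    using c 0 1 by (intro norm_triangle_le add_mono) (auto intro!: mult_left_mono)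
  also have "\<dots> = B" by (simp add: algebra_simps)
  finally show ?case .
qed

text \<open>Estimates by \<open>e\<close> times a fixed constant suffice for convergence; the constant may vanish, so it
  cannot be divided away.\<close>

lemma tendsto_if_dist_le_scaled:
  fixes x :: "'b \<Rightarrow> 'a::metric_space"
  assumes "\<And>e. e > 0 \<Longrightarrow> \<forall>\<^sub>F n in G. dist (x n) l \<le> e * k"
  shows "(x \<longlongrightarrow> l) G"
proof (rule tendstoI)
  fix e :: real assume e: "e > 0"
  have "e / (\<bar>k\<bar> + 1) * k < e"
  proof -
    have "e / (\<bar>k\<bar> + 1) * k \<le> e / (\<bar>k\<bar> + 1) * \<bar>k\<bar>" using e by (intro mult_left_mono) auto
    also have "\<dots> < e" using e by (simp add: field_simps)
    finally show ?thesis .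
  qed
  moreover have "\<forall>\<^sub>F n in G. dist (x n) l \<le> e / (\<bar>k\<bar> + 1) * k"
    using e by (intro assms) auto
  ultimately show "\<forall>\<^sub>F n in G. dist (x n) l < e"
    by (auto elim: eventually_mono)
qed

lemma has_vector_derivative_iff_tendsto:
  "(f has_vector_derivative d) (at x within S) \<longleftrightarrow>
    ((\<lambda>y. (f y - f x) /\<^sub>R (y - x)) \<longlongrightarrow> d) (at x within S)"
proof -
  have "norm (f y - f x - (y - x) *\<^sub>R d) / norm (y - x) = norm ((f y - f x) /\<^sub>R (y - x) - d)"
    if "y \<noteq> x" for y
  proof -
    have "(f y - f x) /\<^sub>R (y - x) - d = (f y - f x - (y - x) *\<^sub>R d) /\<^sub>R (y - x)"
      using that by (simp add: scaleR_diff_right)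
    then show ?thesis by (simp add: divide_inverse mult.commute)
  qed
  then have "((\<lambda>y. norm (f y - f x - (y - x) *\<^sub>R d) / norm (y - x)) \<longlongrightarrow> 0) (at x within S) \<longleftrightarrow>
      ((\<lambda>y. norm ((f y - f x) /\<^sub>R (y - x) - d)) \<longlongrightarrow> 0) (at x within S)"
    by (intro filterlim_cong) (auto simp: eventually_at_filter)
  then show ?thesis
    by (simp add: has_vector_derivative_def has_derivative_iff_norm bounded_linear_scaleR_left
        tendsto_norm_zero_iff LIM_zero_iff)
qed

lemma vector_derivative_lipschitz:
  fixes f :: "real \<Rightarrow> 'b::real_normed_vector"
  assumes "convex T" "s \<in> T" "t \<in> T"
    and "\<And>u. u \<in> T \<Longrightarrow> (f has_vector_derivative f' u) (at u within T)"
    and "\<And>u. u \<in> T \<Longrightarrow> norm (f' u) \<le> c"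
  shows "norm (f s - f t) \<le> c * \<bar>s - t\<bar>"
proof -
  have "onorm (\<lambda>h. h *\<^sub>R f' u) \<le> c" if "u \<in> T" for u
    using assms(5)[OF that] onorm_scaleR_left[OF bounded_linear_ident, of "f' u"]
    by (simp add: onorm_id)
  then show ?thesis
    using differentiable_bound[OF assms(1), of f "\<lambda>u h. h *\<^sub>R f' u" c s t] assms
    by (simp add: has_vector_derivative_def)
qed

section \<open>The bounded functional calculus\<close>

definition bounded_borel :: "(complex \<Rightarrow> complex) \<Rightarrow> bool" where
  "bounded_borel F \<longleftrightarrow> F \<in> borel_measurable borel \<and> bounded (range F)"

lemma bounded_borelI:
  "F \<in> borel_measurable borel \<Longrightarrow> (\<And>z. cmod (F z) \<le> c) \<Longrightarrow> bounded_borel F"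
  by (auto simp: bounded_borel_def bounded_iff)

lemma bounded_borelE:
  assumes "bounded_borel F"
  obtains c where "F \<in> borel_measurable borel" "\<And>z. cmod (F z) \<le> c" "c > 0"
proof -
  obtain b where b: "b > 0" "\<And>x. x \<in> range F \<Longrightarrow> norm x \<le> b"
    using assms unfolding bounded_borel_def bounded_pos by blast
  show ?thesis by (rule that[of b]) (use assms b in \<open>auto simp: bounded_borel_def\<close>)
qed

lemma bounded_borel_add:
  assumes "bounded_borel F" "bounded_borel G"
  shows "bounded_borel (\<lambda>z. F z + G z)"
proof -
  obtain c d where "F \<in> borel_measurable borel" "\<And>z. cmod (F z) \<le> c"
    "G \<in> borel_measurable borel" "\<And>z. cmod (G z) \<le> d" using assms by (metis bounded_borelE)
  then show ?thesis by (intro bounded_borelI[of _ "c + d"]) (auto intro: norm_triangle_mono)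
qed

lemma bounded_borel_mult:
  assumes "bounded_borel F" "bounded_borel G"
  shows "bounded_borel (\<lambda>z. F z * G z)"
proof -
  obtain c d where "F \<in> borel_measurable borel" "\<And>z. cmod (F z) \<le> c" "c > 0"
    "G \<in> borel_measurable borel" "\<And>z. cmod (G z) \<le> d" using assms by (metis bounded_borelE)
  then show ?thesis
    by (intro bounded_borelI[of _ "c * d"]) (auto simp: norm_mult intro!: mult_mono)
qed

lemma bounded_borel_const: "bounded_borel (\<lambda>_. c)"
  by (rule bounded_borelI[of _ "cmod c"]) auto

lemma bounded_borel_indicator:
  assumes "\<delta> \<in> sets borel" shows "bounded_borel (indicator \<delta>)"
  by (rule bounded_borelI[of _ 1]) (use assms in \<open>auto simp: indicator_def\<close>)

lemma bounded_borel_minus: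
  assumes "bounded_borel F" "bounded_borel G"
  shows "bounded_borel (\<lambda>z. F z - G z)"
  using bounded_borel_add[OF assms(1) bounded_borel_mult[OF bounded_borel_const[of "-1"] assms(2)]]
  by simp

lemma simple_function_bounded_borel: "simple_function borel s \<Longrightarrow> bounded_borel s"
  by (auto simp: simple_function_iff_borel_measurable bounded_borel_def finite_imp_bounded)

text \<open>Round the real and imaginary parts down to multiples of \<open>1 / (n + 1)\<close>.\<close>

lemma bounded_borel_uniform_approx:
  assumes "bounded_borel F"
  obtains s where "\<And>n::nat. simple_function borel (s n)"
    "\<And>n z. cmod (s n z - F z) \<le> 2 / real (Suc n)"
proof -
  obtain c where F [measurable]: "F \<in> borel_measurable borel" and c: "\<And>z. cmod (F z) \<le> c"
    using assms by (metis bounded_borelE)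
  define r where "r n x = of_int \<lfloor>real (Suc n) * x\<rfloor> / real (Suc n)" for n x
  define s where "s n z = Complex (r n (Re (F z))) (r n (Im (F z)))" for n z
  have r: "\<bar>r n x - x\<bar> \<le> 1 / real (Suc n)" for n x
  proof -
    have "\<bar>of_int \<lfloor>real (Suc n) * x\<rfloor> - real (Suc n) * x\<bar> \<le> 1" by linarith
    moreover have "r n x - x = (of_int \<lfloor>real (Suc n) * x\<rfloor> - real (Suc n) * x) / real (Suc n)"
      by (simp add: r_def diff_divide_distrib)
    ultimately show ?thesis by (simp add: divide_right_mono)
  qed
  have fin: "finite (r n ` {-c..c})" for n
  proof -
    have "r n ` {-c..c} \<subseteq> (\<lambda>k. of_int k / real (Suc n)) ` {\<lfloor>real (Suc n) * (-c)\<rfloor>..\<lfloor>real (Suc n) * c\<rfloor>}"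
    proof
      fix y assume "y \<in> r n ` {-c..c}"
      then obtain x where x: "y = r n x" "-c \<le> x" "x \<le> c" by auto
      have "\<lfloor>real (Suc n) * (-c)\<rfloor> \<le> \<lfloor>real (Suc n) * x\<rfloor>" "\<lfloor>real (Suc n) * x\<rfloor> \<le> \<lfloor>real (Suc n) * c\<rfloor>"
        using x by (intro floor_mono mult_left_mono; simp)+
      then show "y \<in> (\<lambda>k. of_int k / real (Suc n)) ` {\<lfloor>real (Suc n) * (-c)\<rfloor>..\<lfloor>real (Suc n) * c\<rfloor>}"
        unfolding x(1) r_def by (intro image_eqI[OF refl]) simp
    qed
    then show ?thesis by (rule finite_subset) simp
  qed
  have "simple_function borel (s n)" for n
    unfolding simple_function_iff_borel_measurable
  proof
    have "range (s n) \<subseteq> (\<lambda>(x, y). Complex x y) ` (r n ` {-c..c} \<times> r n ` {-c..c})"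
    proof clarify
      fix z
      have "\<bar>Re (F z)\<bar> \<le> c" "\<bar>Im (F z)\<bar> \<le> c"
        using c[of z] abs_Re_le_cmod[of "F z"] abs_Im_le_cmod[of "F z"] by linarith+
      then show "s n z \<in> (\<lambda>(x, y). Complex x y) ` (r n ` {-c..c} \<times> r n ` {-c..c})"
        unfolding s_def by (intro image_eqI[of _ _ "(r n (Re (F z)), r n (Im (F z)))"]) (auto simp: abs_le_iff)
    qed
    then show "finite (s n ` space borel)"
      using fin by (simp add: finite_subset)
    have "(\<lambda>z. complex_of_real (r n (Re (F z))) + \<i> * complex_of_real (r n (Im (F z)))) \<in> borel_measurable borel"
      unfolding r_def by measurable
    then show "s n \<in> borel_measurable borel"
      by (simp add: s_def[abs_def] Complex_eq)
  qed
  moreover have "cmod (s n z - F z) \<le> 2 / real (Suc n)" for n z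
    using cmod_le[of "s n z - F z"] r[of n "Re (F z)"] r[of n "Im (F z)"] by (simp add: s_def)
  ultimately show ?thesis using that by blast
qed

text \<open>The bound \<open>M\<close> is a parameter so that all estimates can be stated with explicit constants; it
  exists for every spectral measure by \<open>spectral_measure_bounded\<close>.\<close>

locale bounded_spectral_measure =
  fixes E :: "complex set \<Rightarrow> 'a::complex_banach \<Rightarrow> 'a" and M :: real
  assumes spectral: "spectral_measure E"
    and M_nonneg: "0 \<le> M"
    and E_bound: "\<And>\<delta> f. \<delta> \<in> sets borel \<Longrightarrow> norm (E \<delta> f) \<le> M * norm f"
begin

abbreviation "SI \<equiv> simple_spectral_integral E"
abbreviation "\<Phi> \<equiv> bounded_spectral_integral E"

lemma E_clinear: "\<delta> \<in> sets borel \<Longrightarrow> bounded_clinear (E \<delta>)"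
  using spectral by (simp add: spectral_measure_def)

lemma E_bounded_linear: "\<delta> \<in> sets borel \<Longrightarrow> bounded_linear (E \<delta>)"
  using E_clinear by (simp add: bounded_clinear_def)

lemma E_scaleC: "\<delta> \<in> sets borel \<Longrightarrow> E \<delta> (c *\<^sub>C f) = c *\<^sub>C E \<delta> f"
  using E_clinear by (simp add: bounded_clinear_def)

lemma E_UNIV [simp]: "E UNIV f = f"
  using spectral by (simp add: spectral_measure_def)

lemma E_Int:
  "\<delta> \<in> sets borel \<Longrightarrow> \<sigma> \<in> sets borel \<Longrightarrow> E \<delta> (E \<sigma> f) = E (\<delta> \<inter> \<sigma>) f"
  using spectral by (simp add: spectral_measure_def)

lemma E_empty [simp]: "E {} f = 0"
  using spectral_measure_Diff[OF spectral, of UNIV UNIV f] by simp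

lemma E_UN:
  assumes "finite I" "disjoint_family_on D I" "\<And>i. i \<in> I \<Longrightarrow> D i \<in> sets borel"
  shows "E (\<Union>i\<in>I. D i) f = (\<Sum>i\<in>I. E (D i) f)"
  using assms
proof (induction I rule: finite_induct)
  case (insert k I)
  have "(\<Union>i\<in>insert k I. D i) - D k = (\<Union>i\<in>I. D i)"
    using insert by (force simp: disjoint_family_on_def)
  moreover have "(\<Union>i\<in>insert k I. D i) \<in> sets borel"
    using insert by (intro sets.finite_UN) auto
  ultimately have "E (\<Union>i\<in>I. D i) f = E (\<Union>i\<in>insert k I. D i) f - E (D k) f"
    using spectral_measure_Diff[OF spectral, of "D k" "\<Union>i\<in>insert k I. D i" f] insert by auto
  moreover have "E (\<Union>i\<in>I. D i) f = (\<Sum>i\<in>I. E (D i) f)"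
    using insert by (intro insert.IH) (auto simp: disjoint_family_on_def)
  ultimately show ?case using insert by simp
qed simp

text \<open>The integral of a simple function may be computed over any finite partition on which it is
  constant, here the fibres of \<open>g\<close>.  With \<open>g\<close> a pair of simple functions this is the common
  refinement behind additivity and multiplicativity.\<close>

lemma simple_integral_compose:
  assumes g: "simple_function borel g"
  shows "SI (\<lambda>z. h (g z)) f = (\<Sum>b\<in>range g. h b *\<^sub>C E (g -` {b}) f)"
proof -
  have fin: "finite (range g)" and ms: "\<And>b. g -` {b} \<in> sets borel"
    using g by (auto simp: simple_function_def) (metis (no_types) Int_UNIV_right emptyE
      rangeI sets.empty_sets vimage_singleton_eq subsetI subset_empty)
  have piece: "E ((\<lambda>z. h (g z)) -` {c}) f = (\<Sum>b\<in>{b \<in> range g. h b = c}. E (g -` {b}) f)" for c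
  proof -
    have "(\<lambda>z. h (g z)) -` {c} = (\<Union>b\<in>{b \<in> range g. h b = c}. g -` {b})" by auto
    then show ?thesis
      using fin ms by (simp only:) (rule E_UN, auto simp: disjoint_family_on_def)
  qed
  have "SI (\<lambda>z. h (g z)) f =
      (\<Sum>c\<in>range (\<lambda>z. h (g z)). \<Sum>b\<in>{b \<in> range g. h b = c}. h b *\<^sub>C E (g -` {b}) f)"
    unfolding simple_spectral_integral_def piece by (auto simp: scaleC.sum_right intro!: sum.cong)
  also have "\<dots> = (\<Sum>b\<in>range g. h b *\<^sub>C E (g -` {b}) f)"
    using fin by (intro sum.group) (auto simp: image_image[symmetric, of h g])
  finally show ?thesis .
qed

lemma simple_vimage_borel: "simple_function borel s \<Longrightarrow> s -` {c} \<in> sets borel"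
  using simple_functionD(2)[of borel s "{c}"] by simp

lemma simple_integral_add:
  assumes "simple_function borel s" "simple_function borel t"
  shows "SI (\<lambda>z. s z + t z) f = SI s f + SI t f"
proof -
  let ?g = "\<lambda>z. (s z, t z)"
  have g: "simple_function borel ?g" using assms by (rule simple_function_Pair)
  show ?thesis
    using simple_integral_compose[OF g, of "\<lambda>(x, y). x + y" f]
      simple_integral_compose[OF g, of fst f] simple_integral_compose[OF g, of snd f]
    by (simp add: case_prod_beta scaleC_add_left sum.distrib)
qed

lemma simple_integral_mult:
  assumes s: "simple_function borel s" and t: "simple_function borel t"
  shows "SI (\<lambda>z. s z * t z) f = SI s (SI t f)"
proof -
  let ?g = "\<lambda>z. (s z, t z)"
  have g: "simple_function borel ?g" using assms by (rule simple_function_Pair)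
  have fin: "finite (range s)" "finite (range t)" using assms by (auto simp: simple_function_def)
  have lin: "linear (E (s -` {c}))" for c
    using E_bounded_linear[OF simple_vimage_borel[OF s]] by (simp add: bounded_linear.linear)
  have "SI s (SI t f) = (\<Sum>c\<in>range s. \<Sum>d\<in>range t. (c * d) *\<^sub>C E (?g -` {(c, d)}) f)"
  proof -
    have "c *\<^sub>C E (s -` {c}) (d *\<^sub>C E (t -` {d}) f) = (c * d) *\<^sub>C E (?g -` {(c, d)}) f" for c d
    proof -
      have "s -` {c} \<inter> t -` {d} = ?g -` {(c, d)}" by auto
      then show ?thesis
        by (simp add: E_scaleC E_Int scaleC_scaleC simple_vimage_borel s t)
    qed
    then show ?thesis
      unfolding simple_spectral_integral_def by (simp add: linear_sum[OF lin] scaleC.sum_right)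
  qed
  also have "\<dots> = (\<Sum>p\<in>range s \<times> range t. (fst p * snd p) *\<^sub>C E (?g -` {p}) f)"
    by (simp add: sum.cartesian_product case_prod_beta)
  also have "\<dots> = (\<Sum>p\<in>range ?g. (fst p * snd p) *\<^sub>C E (?g -` {p}) f)"
  proof (rule sum.mono_neutral_right)
    show "\<forall>p\<in>range s \<times> range t - range ?g. (fst p * snd p) *\<^sub>C E (?g -` {p}) f = 0"
    proof
      fix p assume "p \<in> range s \<times> range t - range ?g"
      then have "p \<notin> range ?g" by simp
      then have "?g -` {p} = {}" by (auto simp del: prod.inject)
      then show "(fst p * snd p) *\<^sub>C E (?g -` {p}) f = 0" by (simp add: scaleC.zero_right)
    qed
  qed (use fin in auto)
  also have "\<dots> = SI (\<lambda>z. s z * t z) f"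
    using simple_integral_compose[OF g, of "\<lambda>p. fst p * snd p" f] by simp
  finally show ?thesis by simp
qed

lemma simple_integral_const: "SI (\<lambda>_. c) f = c *\<^sub>C f"
  by (simp add: simple_spectral_integral_def)

lemma simple_integral_diff:
  assumes "simple_function borel s" "simple_function borel t"
  shows "SI (\<lambda>z. s z - t z) f = SI s f - SI t f"
  using simple_integral_add[of "\<lambda>z. s z - t z" t f] assms by (simp add: simple_function_diff)

lemma simple_integral_linear:
  assumes s: "simple_function borel s"
  shows "SI s (f + g) = SI s f + SI s g" "SI s (c *\<^sub>C f) = c *\<^sub>C SI s f"
  using E_bounded_linear[OF simple_vimage_borel[OF s]]
  by (simp_all add: simple_spectral_integral_def linear_add bounded_linear.linear scaleC_add_right
      sum.distrib E_scaleC simple_vimage_borel[OF s] scaleC_scaleC scaleC.sum_right mult.commute)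

text \<open>The factor 4 comes from splitting the values into positive and negative parts of their
  real and imaginary parts; each part is covered by \<open>norm_convex_combination_le\<close>.\<close>

lemma norm_simple_integral_le:
  assumes s: "simple_function borel s" and c: "\<And>z. cmod (s z) \<le> c"
  shows "norm (SI s f) \<le> c * (4 * M * norm f)"
proof -
  define x where "x b = E (s -` {b}) f" for b
  have fin: "finite (range s)" using s by (simp add: simple_function_def)
  have c0: "0 \<le> c" using c[of 0] norm_ge_zero order_trans by blast
  have pos: "norm (\<Sum>b\<in>range s. a b *\<^sub>R x b) \<le> c * (M * norm f)"
    if a: "\<And>b. b \<in> range s \<Longrightarrow> 0 \<le> a b \<and> a b \<le> c" for a
  proof (cases "c = 0")
    case True
    then have "a b = 0" if "b \<in> range s" for b using a[OF that] by simp
    then show ?thesis using True by simp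
  next
    case False
    have "norm (0 + (\<Sum>b\<in>range s. (a b / c) *\<^sub>R x b)) \<le> M * norm f"
    proof (rule norm_convex_combination_le[OF fin])
      fix J assume J: "J \<subseteq> range s"
      have "(\<Sum>j\<in>J. x j) = E (\<Union>j\<in>J. s -` {j}) f"
        unfolding x_def using J fin finite_subset simple_vimage_borel[OF s]
        by (intro E_UN[symmetric]) (auto simp: disjoint_family_on_def)
      also have "norm \<dots> \<le> M * norm f"
        using simple_vimage_borel[OF s] J fin
        by (intro E_bound sets.finite_UN) (auto dest: finite_subset)
      finally show "norm (0 + (\<Sum>j\<in>J. x j)) \<le> M * norm f" by simp
    qed (use a False c0 in auto)
    moreover have "(\<Sum>b\<in>range s. a b *\<^sub>R x b) = c *\<^sub>R (\<Sum>b\<in>range s. (a b / c) *\<^sub>R x b)"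
      using False by (simp add: scaleR_sum_right)
    ultimately show ?thesis using c0 by (simp add: mult_left_mono)
  qed
  define S where "S a = (\<Sum>b\<in>range s. a b *\<^sub>R x b)" for a
  have Re: "\<bar>Re b\<bar> \<le> c" and Im: "\<bar>Im b\<bar> \<le> c" if "b \<in> range s" for b
    using that c abs_Re_le_cmod abs_Im_le_cmod order_trans by blast+
  have "b *\<^sub>C x b = (max (Re b) 0) *\<^sub>R x b - (max (- Re b) 0) *\<^sub>R x b
      + \<i> *\<^sub>C ((max (Im b) 0) *\<^sub>R x b - (max (- Im b) 0) *\<^sub>R x b)" for b
  proof -
    have "b = complex_of_real (max (Re b) 0 - max (- Re b) 0)
        + \<i> * complex_of_real (max (Im b) 0 - max (- Im b) 0)"
      by (auto simp: complex_eq_iff)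
    then have "b *\<^sub>C x b = complex_of_real (max (Re b) 0 - max (- Re b) 0) *\<^sub>C x b
        + \<i> *\<^sub>C (complex_of_real (max (Im b) 0 - max (- Im b) 0) *\<^sub>C x b)"
      by (metis scaleC_add_left scaleC_scaleC)
    then show ?thesis by (simp only: scaleC_of_real scaleR_diff_left)
  qed
  then have eq: "SI s f = S (\<lambda>b. max (Re b) 0) - S (\<lambda>b. max (- Re b) 0)
      + \<i> *\<^sub>C (S (\<lambda>b. max (Im b) 0) - S (\<lambda>b. max (- Im b) 0))"
    unfolding simple_spectral_integral_def x_def[symmetric] S_def
    by (simp add: sum.distrib sum_subtractf scaleC.sum_right[symmetric] scaleC.diff_right)
  have "norm (SI s f) \<le> norm (S (\<lambda>b. max (Re b) 0)) + norm (S (\<lambda>b. max (- Re b) 0))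
      + (norm (S (\<lambda>b. max (Im b) 0)) + norm (S (\<lambda>b. max (- Im b) 0)))"
    unfolding eq by (intro norm_triangle_mono norm_triangle_ineq4)
      (simp add: norm_scaleC norm_triangle_ineq4)
  also have "\<dots> \<le> c * (4 * M * norm f)"
  proof -
    have "norm (S (\<lambda>b. max (Re b) 0)) \<le> c * (M * norm f)"
      "norm (S (\<lambda>b. max (- Re b) 0)) \<le> c * (M * norm f)"
      "norm (S (\<lambda>b. max (Im b) 0)) \<le> c * (M * norm f)"
      "norm (S (\<lambda>b. max (- Im b) 0)) \<le> c * (M * norm f)"
      unfolding S_def by (rule pos; use Re Im c0 in \<open>force simp: abs_le_iff\<close>)+
    then show ?thesis by simp
  qed
  finally show ?thesis .
qed

lemma norm_simple_integral_diff_le: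
  assumes "simple_function borel s" "simple_function borel t" "\<And>z. cmod (s z - t z) \<le> e"
  shows "norm (SI s f - SI t f) \<le> e * (4 * M * norm f)"
  using norm_simple_integral_le[of "\<lambda>z. s z - t z" e f] assms
  by (simp add: simple_integral_diff simple_function_diff)

text \<open>Integrals of simple functions that are uniformly close are close, so every approximating
  sequence gives a Cauchy sequence and all give the same limit: the definite description in the
  definition of the integral is meaningful.\<close>

lemma bounded_integral_LIMSEQ:
  assumes F: "bounded_borel F"
    and s: "\<And>n. simple_function borel (s n)" "uniform_limit UNIV s F sequentially"
  shows "(\<lambda>n. SI (s n) f) \<longlonglongrightarrow> \<Phi> F f"
proof -
  let ?lim = "\<lambda>g. \<forall>s. (\<forall>n. simple_function borel (s n)) \<and> uniform_limit UNIV s F sequentially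
      \<longrightarrow> (\<lambda>n. SI (s n) f) \<longlonglongrightarrow> g"
  have near: "\<forall>\<^sub>F n in sequentially. \<forall>z. cmod (t n z - F z) < e"
    if "uniform_limit UNIV t F sequentially" "e > 0" for t e
    using uniform_limitD[OF that] by (simp add: dist_norm)
  have "Cauchy (\<lambda>n. SI (s n) f)"
  proof (rule metric_CauchyI)
    fix e :: real assume e: "e > 0"
    define k where "k = 4 * M * norm f"
    have k: "k \<ge> 0" using M_nonneg by (simp add: k_def)
    have "e / (k + 1) / 2 > 0" using e k by simp
    from near[OF s(2) this] obtain N where
      N: "\<And>n z. n \<ge> N \<Longrightarrow> cmod (s n z - F z) < e / (k + 1) / 2"
      unfolding eventually_sequentially by blast
    show "\<exists>N. \<forall>m\<ge>N. \<forall>n\<ge>N. dist (SI (s m) f) (SI (s n) f) < e"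
    proof (intro exI[of _ N] allI impI)
      fix m n assume "N \<le> m" "N \<le> n"
      then have "cmod (s m z - s n z) \<le> e / (k + 1)" for z
      proof -
        have "cmod (s m z - s n z) \<le> e / (k + 1) / 2 + e / (k + 1) / 2"
          using N[of m z] N[of n z] norm_triangle_ineq4[of "s m z - F z" "s n z - F z"]
            \<open>N \<le> m\<close> \<open>N \<le> n\<close> by simp
        also have "\<dots> = e / (k + 1)" by (rule field_sum_of_halves)
        finally show ?thesis .
      qed
      then have "dist (SI (s m) f) (SI (s n) f) \<le> e / (k + 1) * k"
        unfolding dist_norm k_def by (intro norm_simple_integral_diff_le s)
      also have "\<dots> < e" using e k by (simp add: field_simps)
      finally show "dist (SI (s m) f) (SI (s n) f) < e" .
    qed
  qed
  then obtain g where g: "(\<lambda>n. SI (s n) f) \<longlonglongrightarrow> g" by (auto simp: Cauchy_convergent_iff convergent_def)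
  have "?lim g"
  proof (intro allI impI)
    fix t assume t: "(\<forall>n. simple_function borel (t n)) \<and> uniform_limit UNIV t F sequentially"
    have "(\<lambda>n. SI (t n) f - SI (s n) f) \<longlonglongrightarrow> 0"
    proof (rule tendsto_if_dist_le_scaled)
      fix e :: real assume e: "e > 0"
      have "\<forall>\<^sub>F n in sequentially. (\<forall>z. cmod (t n z - F z) < e / 2) \<and> (\<forall>z. cmod (s n z - F z) < e / 2)"
        using near[of t "e / 2"] near[of s "e / 2"] t s e by (simp add: eventually_conj)
      then show "\<forall>\<^sub>F n in sequentially. dist (SI (t n) f - SI (s n) f) 0 \<le> e * (4 * M * norm f)"
      proof eventually_elim
        case (elim n)
        have "cmod (t n z - s n z) \<le> e" for z
          using elim[THEN conjunct1, rule_format, of z] elim[THEN conjunct2, rule_format, of z]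
            norm_triangle_ineq4[of "t n z - F z" "s n z - F z"] by simp
        then show ?case using t s by (simp add: norm_simple_integral_diff_le)
      qed
    qed
    from tendsto_add[OF this g] show "(\<lambda>n. SI (t n) f) \<longlonglongrightarrow> g" by simp
  qed
  moreover have "g' = g" if "?lim g'" for g'
    using that s g LIMSEQ_unique by blast
  ultimately have "\<Phi> F f = g"
    unfolding bounded_spectral_integral_def by (intro the_equality) blast+
  then show ?thesis using g by simp
qed

lemma bounded_integral_simple:
  assumes s: "simple_function borel s"
  shows "\<Phi> s f = SI s f"
proof (rule LIMSEQ_unique)
  show "(\<lambda>n. SI s f) \<longlonglongrightarrow> \<Phi> s f"
    using s by (intro bounded_integral_LIMSEQ simple_function_bounded_borel) (auto intro: uniform_limit_const)
qed simp

lemma bounded_integral_approx: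
  assumes "bounded_borel F"
  obtains s where "\<And>n::nat. simple_function borel (s n)"
    "\<And>n z. cmod (s n z - F z) \<le> 2 / real (Suc n)" "uniform_limit UNIV s F sequentially"
    "\<And>f. (\<lambda>n. SI (s n) f) \<longlonglongrightarrow> \<Phi> F f"
proof -
  obtain s where s: "\<And>n::nat. simple_function borel (s n)"
    "\<And>n z. cmod (s n z - F z) \<le> 2 / real (Suc n)"
    using bounded_borel_uniform_approx[OF assms] by blast
  have "(\<lambda>n. 2 / real (Suc n)) \<longlonglongrightarrow> 0"
    using tendsto_mult_right_zero[OF LIMSEQ_inverse_real_of_nat, of 2] by (simp add: field_simps)
  then have u: "uniform_limit UNIV s F sequentially"
    unfolding uniform_limit_iff
  proof (intro allI impI)
    fix e :: real assume "e > 0"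
    then have "\<forall>\<^sub>F n in sequentially. 2 / real (Suc n) < e"
      using \<open>(\<lambda>n. 2 / real (Suc n)) \<longlonglongrightarrow> 0\<close> by (rule order_tendstoD(2)[rotated])
    then show "\<forall>\<^sub>F n in sequentially. \<forall>z\<in>UNIV. dist (s n z) (F z) < e"
      by eventually_elim (use s(2) in \<open>auto simp: dist_norm intro: le_less_trans\<close>)
  qed
  show ?thesis by (rule that[OF s u bounded_integral_LIMSEQ[OF assms s(1) u]])
qed

lemma bounded_integral_norm_le:
  assumes F: "F \<in> borel_measurable borel" "\<And>z. cmod (F z) \<le> c"
  shows "norm (\<Phi> F f) \<le> c * (4 * M * norm f)"
proof -
  from bounded_borelI[OF F] obtain s where s: "\<And>n::nat. simple_function borel (s n)"
    "\<And>n z. cmod (s n z - F z) \<le> 2 / real (Suc n)" "\<And>f. (\<lambda>n. SI (s n) f) \<longlonglongrightarrow> \<Phi> F f"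
    using bounded_integral_approx by metis
  have "cmod (s n z) \<le> c + 2 / real (Suc n)" for n z
    using s(2)[of n z] F(2)[of z] norm_triangle_ineq[of "F z" "s n z - F z"] by simp
  then have le: "norm (SI (s n) f) \<le> (c + 2 * inverse (real (Suc n))) * (4 * M * norm f)" for n
    by (intro norm_simple_integral_le s) (simp add: divide_inverse)
  have "(\<lambda>n. (c + 2 * inverse (real (Suc n))) * (4 * M * norm f)) \<longlonglongrightarrow> (c + 2 * 0) * (4 * M * norm f)"
    by (intro tendsto_intros LIMSEQ_inverse_real_of_nat)
  from LIMSEQ_le[OF tendsto_norm[OF s(3)] this] show ?thesis using le by auto
qed

lemma bounded_integral_clinear:
  assumes F: "bounded_borel F"
  shows "bounded_clinear (\<Phi> F)"
proof -
  obtain c where c: "F \<in> borel_measurable borel" "\<And>z. cmod (F z) \<le> c"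
    using F by (metis bounded_borelE)
  from F obtain s where s: "\<And>n::nat. simple_function borel (s n)"
    "\<And>f. (\<lambda>n. SI (s n) f) \<longlonglongrightarrow> \<Phi> F f" using bounded_integral_approx by metis
  show ?thesis
  proof (rule bounded_clinearI)
    fix f g a
    show "\<Phi> F (f + g) = \<Phi> F f + \<Phi> F g"
      using LIMSEQ_unique[OF s(2)[of "f + g"]] tendsto_add[OF s(2)[of f] s(2)[of g]]
      by (simp add: simple_integral_linear s)
    show "\<Phi> F (a *\<^sub>C f) = a *\<^sub>C \<Phi> F f"
      using LIMSEQ_unique[OF s(2)[of "a *\<^sub>C f"]] scaleC.tendsto[OF tendsto_const s(2)[of f], of a]
      by (simp add: simple_integral_linear s)
    show "norm (\<Phi> F f) \<le> (c * 4 * M) * norm f"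
      using bounded_integral_norm_le[OF c] by (simp add: mult.assoc)
  qed
qed

lemma bounded_integral_bounded_linear: "bounded_borel F \<Longrightarrow> bounded_linear (\<Phi> F)"
  using bounded_integral_clinear by (simp add: bounded_clinear_def)

lemma bounded_integral_add:
  assumes F: "bounded_borel F" and G: "bounded_borel G"
  shows "\<Phi> (\<lambda>z. F z + G z) f = \<Phi> F f + \<Phi> G f"
proof -
  obtain s t where s: "\<And>n::nat. simple_function borel (s n)" "uniform_limit UNIV s F sequentially"
      "\<And>f. (\<lambda>n. SI (s n) f) \<longlonglongrightarrow> \<Phi> F f"
    and t: "\<And>n::nat. simple_function borel (t n)" "uniform_limit UNIV t G sequentially"
      "\<And>f. (\<lambda>n. SI (t n) f) \<longlonglongrightarrow> \<Phi> G f"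
    using bounded_integral_approx[OF F] bounded_integral_approx[OF G] by metis
  have "(\<lambda>n. SI (\<lambda>z. s n z + t n z) f) \<longlonglongrightarrow> \<Phi> (\<lambda>z. F z + G z) f"
    by (intro bounded_integral_LIMSEQ bounded_borel_add F G uniform_limit_add s t simple_function_add)
  from LIMSEQ_unique[OF this] show ?thesis
    using tendsto_add[OF s(3)[of f] t(3)[of f]] by (simp add: simple_integral_add s t)
qed

lemma bounded_integral_mult:
  assumes F: "bounded_borel F" and G: "bounded_borel G"
  shows "\<Phi> (\<lambda>z. F z * G z) f = \<Phi> F (\<Phi> G f)"
proof -
  obtain c where c: "\<And>z. cmod (F z) \<le> c" using F by (metis bounded_borelE)
  obtain s where s: "\<And>n::nat. simple_function borel (s n)"
      "\<And>n z. cmod (s n z - F z) \<le> 2 / real (Suc n)" "uniform_limit UNIV s F sequentially"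
      "\<And>f. (\<lambda>n. SI (s n) f) \<longlonglongrightarrow> \<Phi> F f"
    using bounded_integral_approx[OF F] by metis
  obtain t where t: "\<And>n::nat. simple_function borel (t n)" "uniform_limit UNIV t G sequentially"
      "\<And>f. (\<lambda>n. SI (t n) f) \<longlonglongrightarrow> \<Phi> G f"
    using bounded_integral_approx[OF G] by metis
  have 1: "(\<lambda>n. SI (\<lambda>z. s n z * t n z) f) \<longlonglongrightarrow> \<Phi> (\<lambda>z. F z * G z) f"
    using F G by (intro bounded_integral_LIMSEQ bounded_borel_mult uniform_lim_mult s t
        simple_function_mult) (auto simp: bounded_borel_def)
  have sc: "cmod (s n z) \<le> c + 2" for n z
  proof -
    have "2 / real (Suc n) \<le> 2" by (simp add: field_simps)
    then show ?thesis
      using s(2)[of n z] c[of z] norm_triangle_ineq[of "F z" "s n z - F z"] by simp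
  qed
  have "(\<lambda>n. SI (s n) (SI (t n) f - \<Phi> G f)) \<longlonglongrightarrow> 0"
  proof (rule Lim_null_comparison)
    show "\<forall>\<^sub>F n in sequentially. norm (SI (s n) (SI (t n) f - \<Phi> G f))
        \<le> (c + 2) * (4 * M * norm (SI (t n) f - \<Phi> G f))"
      using sc by (intro always_eventually allI norm_simple_integral_le s)
    have "(\<lambda>n. norm (SI (t n) f - \<Phi> G f)) \<longlonglongrightarrow> 0"
      using t(3)[of f] by (simp add: LIM_zero tendsto_norm_zero)
    then show "(\<lambda>n. (c + 2) * (4 * M * norm (SI (t n) f - \<Phi> G f))) \<longlonglongrightarrow> 0"
      by (intro tendsto_mult_right_zero)
  qed
  moreover have "SI (s n) (SI (t n) f) = SI (s n) (SI (t n) f - \<Phi> G f) + SI (s n) (\<Phi> G f)" for n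
    by (simp add: simple_integral_linear(1)[OF s(1), symmetric])
  ultimately have "(\<lambda>n. SI (s n) (SI (t n) f)) \<longlonglongrightarrow> \<Phi> F (\<Phi> G f)"
    using tendsto_add[OF _ s(4)[of "\<Phi> G f"]] by fastforce
  with LIMSEQ_unique[OF 1] show ?thesis by (simp add: simple_integral_mult s t)
qed

lemma bounded_integral_const: "\<Phi> (\<lambda>_. c) f = c *\<^sub>C f"
  by (simp add: bounded_integral_simple simple_integral_const)

lemma bounded_integral_cmult:
  "bounded_borel F \<Longrightarrow> \<Phi> (\<lambda>z. c * F z) f = c *\<^sub>C \<Phi> F f"
  using bounded_integral_mult[OF bounded_borel_const, of F c f] by (simp add: bounded_integral_const)

lemma bounded_integral_diff:
  assumes F: "bounded_borel F" and G: "bounded_borel G"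
  shows "\<Phi> (\<lambda>z. F z - G z) f = \<Phi> F f - \<Phi> G f"
  using bounded_integral_add[OF bounded_borel_minus[OF F G] G, of f] by simp

lemma bounded_integral_indicator:
  assumes \<delta>: "\<delta> \<in> sets borel"
  shows "\<Phi> (indicator \<delta>) f = E \<delta> f"
proof -
  have g: "simple_function borel (\<lambda>z. z \<in> \<delta>)"
  proof -
    have "(\<lambda>z. z \<in> \<delta>) -` {b} = (if b then \<delta> else - \<delta>)" for b by auto
    then show ?thesis using \<delta> by (auto simp: simple_function_def intro: finite_subset[of _ UNIV])
  qed
  have ind: "(indicator \<delta> :: complex \<Rightarrow> complex) = (\<lambda>z. of_bool (z \<in> \<delta>))"
    by (auto simp: indicator_def)
  have "SI (indicator \<delta>) f = (\<Sum>b\<in>range (\<lambda>z. z \<in> \<delta>). of_bool b *\<^sub>C E ((\<lambda>z. z \<in> \<delta>) -` {b}) f)"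
    unfolding ind by (rule simple_integral_compose[OF g])
  also have "\<dots> = (\<Sum>b\<in>{True}. of_bool b *\<^sub>C E ((\<lambda>z. z \<in> \<delta>) -` {b}) f)"
  proof (rule sum.mono_neutral_cong)
    fix b assume "b \<in> {True} - range (\<lambda>z. z \<in> \<delta>)"
    then have "(\<lambda>z. z \<in> \<delta>) -` {b} = {}" by auto
    then show "of_bool b *\<^sub>C E ((\<lambda>z. z \<in> \<delta>) -` {b}) f = 0" by (simp add: scaleC.zero_right)
  qed (auto simp: scaleC.zero_left intro: finite_subset[of _ UNIV])
  also have "\<dots> = E \<delta> f" by (simp add: vimage_def)
  finally show ?thesis
    using \<delta> by (simp add: bounded_integral_simple simple_function_indicator)
qed

text \<open>Countable additivity applied to the successive differences.\<close>

lemma E_incseq_LIMSEQ: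
  assumes D: "\<And>n. D n \<in> sets borel" "incseq D" "(\<Union>n. D n) = UNIV"
  shows "(\<lambda>n. E (D n) f) \<longlonglongrightarrow> f"
proof -
  have dis: "disjoint_family (disjointed D)" by (rule disjoint_family_disjointed)
  have db: "disjointed D n \<in> sets borel" for n
    using D(1) by (auto simp: disjointed_def)
  have "(\<lambda>n. E (disjointed D n) f) sums E (\<Union>n. disjointed D n) f"
    using spectral dis db unfolding spectral_measure_def by blast
  moreover have "(\<Union>n. disjointed D n) = UNIV" using D(3) by (simp add: UN_disjointed_eq)
  moreover have "(\<Sum>i<Suc n. E (disjointed D i) f) = E (D n) f" for n
  proof -
    have "(\<Union>i<Suc n. disjointed D i) = (\<Union>i<Suc n. D i)"
      using finite_UN_disjointed_eq[of D "Suc n"] by (simp add: atLeast0LessThan)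
    also have "\<dots> = D n" using incseqD[OF D(2)] by (fastforce simp: less_Suc_eq_le)
    finally have "E (D n) f = E (\<Union>i<Suc n. disjointed D i) f" by simp
    also have "\<dots> = (\<Sum>i<Suc n. E (disjointed D i) f)"
      using db dis by (intro E_UN) (auto simp: disjoint_family_on_def)
    finally show ?thesis by simp
  qed
  ultimately show ?thesis
    unfolding sums_def using LIMSEQ_Suc[of "\<lambda>n. \<Sum>i<n. E (disjointed D i) f"] by fastforce
qed

text \<open>With \<open>D N\<close> the set where \<open>F n\<close> is \<open>e\<close>-close to \<open>G\<close> for all \<open>n \<ge> N\<close>, the integral of
  \<open>F n - G\<close> is small on \<open>D N\<close> by the uniform estimate, and the part of \<open>y\<close> outside \<open>D N\<close> is small
  by continuity of \<open>E\<close> from below.  Moving the vector along with the integrand gives the product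
  rule below.\<close>

lemma bounded_integral_dominated_LIMSEQ:
  assumes F: "\<And>n::nat. F n \<in> borel_measurable borel" "G \<in> borel_measurable borel"
    and c: "\<And>n z. cmod (F n z) \<le> c"
    and lim: "\<And>z. (\<lambda>n. F n z) \<longlonglongrightarrow> G z"
    and x: "x \<longlonglongrightarrow> y"
  shows "(\<lambda>n. \<Phi> (F n) (x n)) \<longlonglongrightarrow> \<Phi> G y"
proof -
  have cG: "cmod (G z) \<le> c" for z
    by (rule Lim_norm_ubound[OF _ lim]) (simp_all add: c)
  have bF: "bounded_borel (F n)" for n using F c by (intro bounded_borelI[of _ c])
  have bG: "bounded_borel G" using F cG by (intro bounded_borelI[of _ c])
  have c0: "c \<ge> 0" using cG[of 0] norm_ge_zero order_trans by blast
  define H where "H n z = F n z - G z" for n z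
  have mH: "H n \<in> borel_measurable borel" for n
    using F unfolding H_def[abs_def] by measurable
  have cH: "cmod (H n z) \<le> 2 * c" for n z
    using norm_triangle_ineq4[of "F n z" "G z"] c[of n z] cG[of z] by (simp add: H_def)
  have bH: "bounded_borel (H n)" for n using mH cH by (rule bounded_borelI)
  have H0: "(\<lambda>n. \<Phi> (H n) y) \<longlonglongrightarrow> 0"
  proof (rule tendsto_if_dist_le_scaled)
    fix e :: real assume e: "e > 0"
    define D where "D N = {z. \<forall>n. N \<le> n \<longrightarrow> cmod (H n z) \<le> e}" for N
    have D_borel: "D N \<in> sets borel" for N
    proof -
      have "D N = (\<Inter>n\<in>{N..}. {z \<in> space borel. cmod (H n z) \<le> e})" by (auto simp: D_def)
      moreover have "{z \<in> space borel. cmod (H n z) \<le> e} \<in> sets borel" for n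
        using mH[of n] by (intro borel_measurable_le) auto
      ultimately show ?thesis by (auto intro!: sets.countable_INT')
    qed
    have "(\<lambda>N. E (D N) y) \<longlonglongrightarrow> y"
    proof (rule E_incseq_LIMSEQ[OF D_borel])
      show "incseq D" by (auto simp: incseq_def D_def)
      have "\<exists>N. z \<in> D N" for z
      proof -
        have "\<forall>\<^sub>F n in sequentially. dist (F n z) (G z) < e" using lim e by (rule tendstoD)
        then show ?thesis unfolding eventually_sequentially D_def H_def dist_norm
          by (auto intro: less_imp_le)
      qed
      then show "(\<Union>N. D N) = UNIV" by auto
    qed
    then have "\<forall>\<^sub>F N in sequentially. dist (E (D N) y) y < e" using e by (rule tendstoD)
    then obtain N where N: "norm (y - E (D N) y) < e"
      by (auto simp: eventually_sequentially dist_norm norm_minus_commute)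
    have "norm (\<Phi> (H n) y) \<le> e * (4 * M * norm y + 2 * c * (4 * M))" if n: "n \<ge> N" for n
    proof -
      let ?I = "indicator (D N) :: complex \<Rightarrow> complex"
      have "\<Phi> (H n) y = \<Phi> (H n) (E (D N) y) + \<Phi> (H n) (y - E (D N) y)"
        using bounded_integral_bounded_linear[OF bH]
        by (simp add: linear_diff bounded_linear.linear)
      also have "\<Phi> (H n) (E (D N) y) = \<Phi> (\<lambda>z. H n z * ?I z) y"
        using bounded_integral_mult[OF bH bounded_borel_indicator[OF D_borel]]
        by (simp add: bounded_integral_indicator D_borel)
      also have "norm (\<Phi> (\<lambda>z. H n z * ?I z) y + \<Phi> (H n) (y - E (D N) y))
          \<le> e * (4 * M * norm y) + 2 * c * (4 * M * norm (y - E (D N) y))"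
      proof (intro norm_triangle_mono bounded_integral_norm_le)
        show "(\<lambda>z. H n z * ?I z) \<in> borel_measurable borel" using mH D_borel by measurable
        show "cmod (H n z * ?I z) \<le> e" for z
          using n e by (auto simp: indicator_def D_def)
      qed (use mH cH in auto)
      also have "\<dots> \<le> e * (4 * M * norm y) + 2 * c * (4 * M * e)"
        using N c0 M_nonneg by (intro add_left_mono mult_left_mono) auto
      finally show ?thesis by (simp add: algebra_simps)
    qed
    then show "\<forall>\<^sub>F n in sequentially. dist (\<Phi> (H n) y) 0 \<le> e * (4 * M * norm y + 2 * c * (4 * M))"
      by (auto simp: eventually_sequentially)
  qed
  have "(\<lambda>n. \<Phi> (F n) (x n - y)) \<longlonglongrightarrow> 0"
  proof (rule Lim_null_comparison)
    show "\<forall>\<^sub>F n in sequentially. norm (\<Phi> (F n) (x n - y)) \<le> c * (4 * M * norm (x n - y))"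
      using F c by (intro always_eventually allI bounded_integral_norm_le)
    have "(\<lambda>n. norm (x n - y)) \<longlonglongrightarrow> 0" using x by (simp add: LIM_zero tendsto_norm_zero)
    then show "(\<lambda>n. c * (4 * M * norm (x n - y))) \<longlonglongrightarrow> 0" by (intro tendsto_mult_right_zero)
  qed
  from tendsto_add[OF tendsto_add[OF this H0] tendsto_const[of "\<Phi> G y"]]
  have "(\<lambda>n. \<Phi> (F n) (x n - y) + \<Phi> (H n) y + \<Phi> G y) \<longlonglongrightarrow> \<Phi> G y" by simp
  moreover have "\<Phi> (F n) (x n - y) + \<Phi> (H n) y + \<Phi> G y = \<Phi> (F n) (x n)" for n
    using bounded_integral_diff[OF bF bG, of n y] bounded_integral_bounded_linear[OF bF]
    by (simp add: H_def[abs_def] linear_diff bounded_linear.linear)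
  ultimately show ?thesis by simp
qed

lemma bounded_integral_dominated_within:
  fixes F :: "real \<Rightarrow> complex \<Rightarrow> complex"
  assumes F: "\<And>t. t \<in> T \<Longrightarrow> F t \<in> borel_measurable borel" "G \<in> borel_measurable borel"
    and c: "\<And>t z. t \<in> T \<Longrightarrow> cmod (F t z) \<le> c"
    and lim: "\<And>z. ((\<lambda>t. F t z) \<longlongrightarrow> G z) (at t0 within T)"
    and x: "(x \<longlongrightarrow> y) (at t0 within T)"
  shows "((\<lambda>t. \<Phi> (F t) (x t)) \<longlongrightarrow> \<Phi> G y) (at t0 within T)"
  unfolding tendsto_at_iff_sequentially comp_def
proof (intro allI impI)
  fix r :: "nat \<Rightarrow> real" assume r: "\<forall>i. r i \<in> T - {t0}" "r \<longlonglongrightarrow> t0"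
  show "(\<lambda>n. \<Phi> (F (r n)) (x (r n))) \<longlonglongrightarrow> \<Phi> G y"
  proof (rule bounded_integral_dominated_LIMSEQ[where c = c])
    show "(\<lambda>n. F (r n) z) \<longlonglongrightarrow> G z" for z
      using lim[of z] r unfolding tendsto_at_iff_sequentially comp_def by blast
    show "(\<lambda>n. x (r n)) \<longlonglongrightarrow> y"
      using x r unfolding tendsto_at_iff_sequentially comp_def by blast
  qed (use F c r in auto)
qed

text \<open>The difference quotients of \<open>F\<close> converge pointwise and are bounded by the bound on the
  derivative, so dominated convergence applies to both terms of the product rule.\<close>

lemma bounded_integral_has_vector_derivative:
  fixes F F' :: "real \<Rightarrow> complex \<Rightarrow> complex"
  assumes T: "convex T" "t0 \<in> T"
    and F: "\<And>t. t \<in> T \<Longrightarrow> F t \<in> borel_measurable borel" "F' t0 \<in> borel_measurable borel"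
    and c: "\<And>t z. t \<in> T \<Longrightarrow> cmod (F t z) \<le> c" "\<And>t z. t \<in> T \<Longrightarrow> cmod (F' t z) \<le> c'"
    and der: "\<And>t z. t \<in> T \<Longrightarrow> ((\<lambda>t. F t z) has_vector_derivative F' t z) (at t within T)"
    and x: "(x has_vector_derivative x') (at t0 within T)"
  shows "((\<lambda>t. \<Phi> (F t) (x t)) has_vector_derivative \<Phi> (F' t0) (x t0) + \<Phi> (F t0) x') (at t0 within T)"
proof -
  have lip: "cmod (F s z - F t z) \<le> c' * \<bar>s - t\<bar>" if "s \<in> T" "t \<in> T" for s t z
    using vector_derivative_lipschitz[OF T(1) that der c(2)] .
  have bF: "bounded_borel (F t)" if "t \<in> T" for t
    using F(1) c(1) that by (intro bounded_borelI[of _ c])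
  let ?Q = "\<lambda>t z. (F t z - F t0 z) /\<^sub>R (t - t0)"
  have lim1: "((\<lambda>t. \<Phi> (?Q t) (x t0)) \<longlongrightarrow> \<Phi> (F' t0) (x t0)) (at t0 within T)"
  proof (rule bounded_integral_dominated_within[where c = "\<bar>c'\<bar>"])
    show "?Q t \<in> borel_measurable borel" if "t \<in> T" for t
      using F(1)[OF that] F(1)[OF T(2)] by measurable
    show "cmod (?Q t z) \<le> \<bar>c'\<bar>" if "t \<in> T" for t z
    proof (cases "t = t0")
      case False
      have "cmod (?Q t z) = cmod (F t z - F t0 z) / \<bar>t - t0\<bar>"
        by (simp add: divide_inverse mult.commute)
      also have "\<dots> \<le> c'" using lip[OF that T(2), of z] False by (simp add: pos_divide_le_eq)
      finally show ?thesis by simp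
    qed simp
    show "((\<lambda>t. ?Q t z) \<longlongrightarrow> F' t0 z) (at t0 within T)" for z
      using der[OF T(2), of z] by (simp only: has_vector_derivative_iff_tendsto)
  qed (use F in auto)
  have lim2: "((\<lambda>t. \<Phi> (F t) ((x t - x t0) /\<^sub>R (t - t0))) \<longlongrightarrow> \<Phi> (F t0) x') (at t0 within T)"
  proof (rule bounded_integral_dominated_within[where c = c])
    show "((\<lambda>t. F t z) \<longlongrightarrow> F t0 z) (at t0 within T)" for z
      using has_vector_derivative_continuous[OF der[OF T(2), of z]] by (simp add: continuous_within)
    show "((\<lambda>t. (x t - x t0) /\<^sub>R (t - t0)) \<longlongrightarrow> x') (at t0 within T)"
      using x by (simp only: has_vector_derivative_iff_tendsto)
  qed (use F c T in auto)
  have "\<Phi> (?Q t) (x t0) + \<Phi> (F t) ((x t - x t0) /\<^sub>R (t - t0))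
      = (\<Phi> (F t) (x t) - \<Phi> (F t0) (x t0)) /\<^sub>R (t - t0)" if t: "t \<in> T" for t
  proof -
    have "?Q t = (\<lambda>z. complex_of_real (inverse (t - t0)) * (F t z - F t0 z))"
      by (simp add: scaleR_conv_of_real)
    then have "\<Phi> (?Q t) (x t0) = (\<Phi> (F t) (x t0) - \<Phi> (F t0) (x t0)) /\<^sub>R (t - t0)"
      using bF t T(2)
      by (simp only: bounded_integral_cmult bounded_borel_minus bounded_integral_diff scaleC_of_real)
    moreover have "\<Phi> (F t) ((x t - x t0) /\<^sub>R (t - t0)) = (\<Phi> (F t) (x t) - \<Phi> (F t) (x t0)) /\<^sub>R (t - t0)"
      using bounded_integral_bounded_linear[OF bF[OF t]]
      by (simp add: linear_diff linear_scale bounded_linear.linear)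
    ultimately show ?thesis by (simp only:) (simp add: scaleR_diff_right)
  qed
  then have "\<forall>\<^sub>F t in at t0 within T. \<Phi> (?Q t) (x t0) + \<Phi> (F t) ((x t - x t0) /\<^sub>R (t - t0))
      = (\<Phi> (F t) (x t) - \<Phi> (F t0) (x t0)) /\<^sub>R (t - t0)"
    by (auto simp: eventually_at_filter)
  from Lim_transform_eventually[OF tendsto_add[OF lim1 lim2] this]
  show ?thesis unfolding has_vector_derivative_iff_tendsto .
qed

lemma bounded_integral_E_commute:
  assumes "bounded_borel G" "\<delta> \<in> sets borel"
  shows "E \<delta> (\<Phi> G f) = \<Phi> (\<lambda>z. G z * indicator \<delta> z) f"
    and "\<Phi> G (E \<delta> f) = \<Phi> (\<lambda>z. G z * indicator \<delta> z) f"
  using bounded_integral_mult[OF bounded_borel_indicator[OF assms(2)] assms(1), of f]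
    bounded_integral_mult[OF assms(1) bounded_borel_indicator[OF assms(2)], of f]
  by (simp_all add: bounded_integral_indicator assms mult.commute)

lemma power_exp_integral_has_vector_derivative:
  assumes S: "S \<in> sets borel" and t0: "t0 \<in> {p<..<q}"
    and b: "\<And>t z. t \<in> {p..q} \<Longrightarrow> z \<in> S \<Longrightarrow> cmod z ^ n * exp (t * Re z) \<le> c"
      "\<And>t z. t \<in> {p..q} \<Longrightarrow> z \<in> S \<Longrightarrow> cmod z ^ Suc n * exp (t * Re z) \<le> c'"
  shows "((\<lambda>t. \<Phi> (\<lambda>z. z ^ n * exp (t *\<^sub>R z) * indicator S z) f) has_vector_derivative
    \<Phi> (\<lambda>z. z ^ Suc n * exp (t0 *\<^sub>R z) * indicator S z) f) (at t0)"
proof -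
  let ?F = "\<lambda>n t z. z ^ n * exp (t *\<^sub>R z) * indicator S z :: complex"
  have mF: "?F n t \<in> borel_measurable borel" for n t using S by measurable
  have bF: "cmod (?F n t z) \<le> \<bar>c\<bar>" "cmod (?F (Suc n) t z) \<le> \<bar>c'\<bar>" if "t \<in> {p..q}" for t z
    using b[OF that, of z] by (auto simp: indicator_def norm_mult norm_power)
  have "((\<lambda>t. \<Phi> (?F n t) f) has_vector_derivative \<Phi> (?F (Suc n) t0) f + \<Phi> (?F n t0) 0)
      (at t0 within {p..q})"
  proof (rule bounded_integral_has_vector_derivative[where c = "\<bar>c\<bar>" and c' = "\<bar>c'\<bar>"])
    fix t :: real and z :: complex
    have "((\<lambda>t. exp (t *\<^sub>R z)) has_vector_derivative exp (t *\<^sub>R z) * z) (at t within {p..q})"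
      by (rule exp_scaleR_has_vector_derivative_right)
    from has_vector_derivative_mult_left[OF has_vector_derivative_mult_right[OF this, of "z ^ n"], of "indicator S z"]
    show "((\<lambda>t. ?F n t z) has_vector_derivative ?F (Suc n) t z) (at t within {p..q})"
      by (simp add: mult_ac)
  qed (use mF bF t0 in \<open>simp_all del: power_Suc\<close>)
  moreover have "\<Phi> (?F n t0) 0 = 0"
    using bounded_integral_bounded_linear[OF bounded_borelI[OF mF bF(1)]] t0
    by (simp add: linear_0 bounded_linear.linear)
  moreover have "at t0 within {p..q} = at t0"
    using t0 by (intro at_within_interior) (simp add: interior_atLeastAtMost_real)
  ultimately show ?thesis by simp
qed

end

section \<open>Scalar type operators and their compact parts\<close>

locale spectral_operator = bounded_spectral_measure E M
  for E :: "complex set \<Rightarrow> 'a::complex_banach \<Rightarrow> 'a" and M :: real +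
  fixes A :: "'a operator"
  assumes A_eq: "A = spectral_integral E (spectrum A) (\<lambda>z. z)"
    and E_spectrum: "E (spectrum A) = id"
begin

text \<open>The bounded parts of the spectrum, which exhaust it and on which \<open>A\<close> acts as a bounded
  operator.\<close>

definition K :: "nat \<Rightarrow> complex set" where
  "K n = {z \<in> spectrum A. cmod z \<le> real n}"

lemma compact_K: "compact (K n)"
proof -
  have "K n = spectrum A \<inter> cball 0 (real n)" by (auto simp: K_def)
  then show ?thesis by (simp add: closed_Int_compact closed_spectrum)
qed

lemma K_borel [measurable]: "K n \<in> sets borel"
  using compact_K by (simp add: borel_compact)

lemma spectrum_borel [measurable]: "spectrum A \<in> sets borel"
  by (simp add: closed_spectrum)

lemma bounded_borel_cut:
  assumes "continuous_on UNIV H"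
  shows "bounded_borel (\<lambda>z. H z * indicator (K n) z)"
proof -
  have "bounded (H ` K n)"
    using assms compact_K by (meson compact_continuous_image compact_imp_bounded continuous_on_subset subset_UNIV)
  then obtain c where "\<And>z. z \<in> K n \<Longrightarrow> cmod (H z) \<le> c" by (auto simp: bounded_iff)
  moreover have [measurable]: "H \<in> borel_measurable borel"
    using assms by (rule borel_measurable_continuous_onI)
  ultimately show ?thesis
    by (intro bounded_borelI[of _ "\<bar>c\<bar>"]) (force simp: indicator_def)+
qed

lemma E_K_LIMSEQ: "(\<lambda>n. E (K n) f) \<longlonglongrightarrow> f"
proof -
  have "(\<lambda>n. E (K n \<union> - spectrum A) f) \<longlonglongrightarrow> f"
  proof (rule E_incseq_LIMSEQ)
    show "incseq (\<lambda>n. K n \<union> - spectrum A)" by (force simp: incseq_def K_def)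
    show "(\<Union>n. K n \<union> - spectrum A) = UNIV"
      using real_arch_simple by (fastforce simp: K_def)
  qed auto
  moreover have "E (K n \<union> - spectrum A) f = E (K n) f" for n
  proof -
    have "E (K n \<union> - spectrum A) (E (spectrum A) f) = E ((K n \<union> - spectrum A) \<inter> spectrum A) f"
      by (intro E_Int) auto
    moreover have "(K n \<union> - spectrum A) \<inter> spectrum A = K n" by (auto simp: K_def)
    ultimately show ?thesis by (simp add: E_spectrum)
  qed
  ultimately show ?thesis by simp
qed

lemma E_K_eqI: "(\<And>n. E (K n) f = E (K n) g) \<Longrightarrow> f = g"
  using LIMSEQ_unique[OF E_K_LIMSEQ[of f]] E_K_LIMSEQ[of g] by simp

lemma indicator_K_mult: "m \<le> n \<Longrightarrow> indicator (K n) z * indicator (K m) z = (indicator (K m) z :: complex)"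
  by (auto simp: indicator_def K_def)

text \<open>Applying \<open>E (K m)\<close> to the truncated integrals makes the limit in the definition of \<open>A\<close>
  eventually constant; conversely \<open>E (K n) g\<close> always tends to \<open>g\<close>.  This replaces limits by an
  identity between bounded operators for each \<open>n\<close>.\<close>

lemma mem_operator_iff:
  "(f, g) \<in> A \<longleftrightarrow> (\<forall>n. E (K n) g = \<Phi> (\<lambda>z. z * indicator (K n) z) f)"
proof -
  have tr: "truncation (spectrum A) (\<lambda>z. z) n = (\<lambda>z. z * indicator (K n) z)" for n
    by (simp add: truncation_def K_def)
  have "(f, g) \<in> A \<longleftrightarrow> (\<lambda>n. \<Phi> (\<lambda>z. z * indicator (K n) z) f) \<longlonglongrightarrow> g"
    by (subst A_eq) (simp add: spectral_integral_def tr)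
  also have "\<dots> \<longleftrightarrow> (\<forall>n. E (K n) g = \<Phi> (\<lambda>z. z * indicator (K n) z) f)"
  proof (intro iffI allI)
    fix m assume lim: "(\<lambda>n. \<Phi> (\<lambda>z. z * indicator (K n) z) f) \<longlonglongrightarrow> g"
    have "E (K m) (\<Phi> (\<lambda>z. z * indicator (K n) z) f) = \<Phi> (\<lambda>z. z * indicator (K m) z) f" if "m \<le> n" for n
      using that by (simp add: bounded_integral_E_commute bounded_borel_cut indicator_K_mult mult.assoc)
    then have "\<forall>\<^sub>F n in sequentially.
        E (K m) (\<Phi> (\<lambda>z. z * indicator (K n) z) f) = \<Phi> (\<lambda>z. z * indicator (K m) z) f"
      by (auto simp: eventually_sequentially)
    then have "(\<lambda>n. E (K m) (\<Phi> (\<lambda>z. z * indicator (K n) z) f)) \<longlonglongrightarrow> \<Phi> (\<lambda>z. z * indicator (K m) z) f"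
      by (rule tendsto_eventually)
    with bounded_linear.tendsto[OF E_bounded_linear[OF K_borel] lim]
    show "E (K m) g = \<Phi> (\<lambda>z. z * indicator (K m) z) f" by (rule LIMSEQ_unique)
  next
    assume "\<forall>n. E (K n) g = \<Phi> (\<lambda>z. z * indicator (K n) z) f"
    then show "(\<lambda>n. \<Phi> (\<lambda>z. z * indicator (K n) z) f) \<longlonglongrightarrow> g"
      using E_K_LIMSEQ[of g] by simp
  qed
  finally show ?thesis .
qed

text \<open>If \<open>E\<close> vanished on a ball around \<open>z0\<close>, the function \<open>1 / (z0 - w)\<close> would be bounded where \<open>E\<close>
  lives, and its integral would be the resolvent at \<open>z0\<close>.\<close>

lemma spectral_projection_ball_nonzero:
  assumes z0: "z0 \<in> spectrum A" and e: "e > 0"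
  obtains f where "f \<noteq> 0" "E (ball z0 e) f = f"
proof (cases "\<exists>g. E (ball z0 e) g \<noteq> 0")
  case True
  then obtain g where "E (ball z0 e) g \<noteq> 0" by blast
  then show ?thesis using that[of "E (ball z0 e) g"] by (simp add: E_Int)
next
  case False
  let ?\<delta> = "- ball z0 e"
  have [measurable]: "?\<delta> \<in> sets borel" by simp
  have \<delta>: "E ?\<delta> g = g" for g
    using False spectral_measure_Diff[OF spectral, of "ball z0 e" UNIV g] by (simp add: Compl_eq_Diff_UNIV)
  define G where "G = (\<lambda>w. indicator ?\<delta> w / (z0 - w))"
  have bG: "bounded_borel G"
  proof (rule bounded_borelI[of _ "1 / e"])
    show "G \<in> borel_measurable borel" unfolding G_def by measurable
    show "cmod (G z) \<le> 1 / e" for z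
      using e by (auto simp: G_def indicator_def norm_divide dist_norm frac_le)
  qed
  let ?c = "\<lambda>n w. (z0 - w) * indicator (K n) w"
  have bc: "bounded_borel (?c n)" for n by (intro bounded_borel_cut continuous_intros)
  have inv: "\<Phi> G (\<Phi> (?c n) f) = E (K n) f" "\<Phi> (?c n) (\<Phi> G f) = E (K n) f" for n f
  proof -
    have 1: "(\<lambda>w. G w * ?c n w) = indicator (K n \<inter> ?\<delta>)" "(\<lambda>w. ?c n w * G w) = indicator (K n \<inter> ?\<delta>)"
      using e by (auto simp: G_def indicator_def fun_eq_iff)
    have "E (K n \<inter> ?\<delta>) f = E (K n) f" using E_Int[of "K n" ?\<delta> f] by (simp add: \<delta>)
    then show "\<Phi> G (\<Phi> (?c n) f) = E (K n) f" "\<Phi> (?c n) (\<Phi> G f) = E (K n) f"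
      by (simp_all add: bounded_integral_mult[OF bG bc, symmetric] 1
          bounded_integral_mult[OF bc bG, symmetric] bounded_integral_indicator)
  qed
  have split: "\<Phi> (?c n) f = z0 *\<^sub>C E (K n) f - \<Phi> (\<lambda>w. w * indicator (K n) w) f" for n f
  proof -
    have "?c n = (\<lambda>w. z0 * indicator (K n) w - w * indicator (K n) w)" by (simp add: algebra_simps)
    then show ?thesis
      by (simp add: bounded_integral_diff bounded_borel_cut bounded_integral_cmult
          bounded_borel_indicator bounded_integral_indicator)
  qed
  have EK: "E (K n) (c *\<^sub>C x - y) = c *\<^sub>C E (K n) x - E (K n) y" for n c x y
    using E_bounded_linear[OF K_borel] by (simp add: linear_diff bounded_linear.linear E_scaleC)
  have "{(z0 *\<^sub>C x - y, x) | x y. (x, y) \<in> A} = {(v, \<Phi> G v) | v. True}" (is "?l = ?r")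
  proof
    show "?l \<subseteq> ?r"
    proof clarify
      fix x y assume xy: "(x, y) \<in> A"
      have "E (K n) (\<Phi> G (z0 *\<^sub>C x - y)) = E (K n) x" for n
      proof -
        have "E (K n) (\<Phi> G (z0 *\<^sub>C x - y)) = \<Phi> G (E (K n) (z0 *\<^sub>C x - y))"
          by (simp add: bounded_integral_E_commute bG)
        also have "E (K n) (z0 *\<^sub>C x - y) = \<Phi> (?c n) x"
          using xy by (simp add: EK split mem_operator_iff)
        finally show ?thesis by (simp add: inv)
      qed
      then have "\<Phi> G (z0 *\<^sub>C x - y) = x" by (rule E_K_eqI)
      then show "\<exists>v. (z0 *\<^sub>C x - y, x) = (v, \<Phi> G v) \<and> True" by auto
    qed
    show "?r \<subseteq> ?l"
    proof clarify
      fix v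
      have "(\<Phi> G v, z0 *\<^sub>C \<Phi> G v - v) \<in> A"
        unfolding mem_operator_iff
      proof
        fix n
        have "E (K n) (z0 *\<^sub>C \<Phi> G v - v) = z0 *\<^sub>C E (K n) (\<Phi> G v) - \<Phi> (?c n) (\<Phi> G v)"
          by (simp add: EK inv)
        then show "E (K n) (z0 *\<^sub>C \<Phi> G v - v) = \<Phi> (\<lambda>w. w * indicator (K n) w) (\<Phi> G v)"
          by (simp add: split)
      qed
      moreover have "v = z0 *\<^sub>C \<Phi> G v - (z0 *\<^sub>C \<Phi> G v - v)" by simp
      ultimately show "\<exists>x y. (v, \<Phi> G v) = (z0 *\<^sub>C x - y, x) \<and> (x, y) \<in> A" by blast
    qed
  qed
  then have "z0 \<in> resolvent_set A"
    unfolding resolvent_set_def using bounded_integral_clinear[OF bG] by blast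
  then show ?thesis using z0 by (simp add: spectrum_def)
qed

lemma cut_power_exp_has_vector_derivative:
  "((\<lambda>t. \<Phi> (\<lambda>z. z ^ n * exp (t *\<^sub>R z) * indicator (K m) z) f) has_vector_derivative
    \<Phi> (\<lambda>z. z ^ Suc n * exp (t0 *\<^sub>R z) * indicator (K m) z) f) (at t0)"
proof (rule power_exp_integral_has_vector_derivative[where p = "t0 - 1" and q = "t0 + 1"])
  have *: "cmod z ^ n * exp (t * Re z) \<le> real m ^ n * exp ((\<bar>t0\<bar> + 1) * real m)"
    if "t \<in> {t0 - 1..t0 + 1}" "z \<in> K m" for t z n
  proof (intro mult_mono power_mono)
    have "t * Re z \<le> \<bar>t\<bar> * \<bar>Re z\<bar>" by (metis abs_ge_self abs_mult)
    also have "\<dots> \<le> (\<bar>t0\<bar> + 1) * real m"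
      using that abs_Re_le_cmod[of z] by (intro mult_mono) (auto simp: K_def)
    finally show "exp (t * Re z) \<le> exp ((\<bar>t0\<bar> + 1) * real m)" by simp
  qed (use that in \<open>auto simp: K_def\<close>)
  show "cmod z ^ n * exp (t * Re z) \<le> real m ^ n * exp ((\<bar>t0\<bar> + 1) * real m)"
    "cmod z ^ Suc n * exp (t * Re z) \<le> real m ^ Suc n * exp ((\<bar>t0\<bar> + 1) * real m)"
    if "t \<in> {t0 - 1..t0 + 1}" "z \<in> K m" for t z
    using *[OF that] by blast+
qed auto

end

lemma scalar_type_spectral_obtains:
  fixes A :: "'a::complex_banach operator"
  assumes "scalar_type_spectral A"
  obtains E M where "spectral_operator E M A"
proof -
  obtain E where E: "spectral_measure E" "E (spectrum A) = id"
    "A = spectral_integral E (spectrum A) (\<lambda>z. z)"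
    using assms by (auto simp: scalar_type_spectral_def)
  obtain M where "0 \<le> M" "\<And>\<delta> f. \<delta> \<in> sets borel \<Longrightarrow> norm (E \<delta> f) \<le> M * norm f"
    using spectral_measure_bounded[OF E(1)] by blast
  then show ?thesis
    by (intro that[of E M] spectral_operator.intro bounded_spectral_measure.intro
        spectral_operator_axioms.intro E)
qed

section \<open>Growth of the exponential on the spectrum\<close>

text \<open>A quantitative form of \<open>(ln w)\<^sup>2 = o(w)\<close>, from \<open>ln w = 4 ln w\<^sup>1\<^sup>/\<^sup>4 \<le> 4 w\<^sup>1\<^sup>/\<^sup>4\<close>
  and completing the square.\<close>

lemma ln_squared_le:
  fixes w B :: real
  assumes "w \<ge> 1" "B > 0"
  shows "B * (ln w)\<^sup>2 \<le> w / 2 + 128 * B\<^sup>2"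
proof -
  \<comment> \<open>The fourth root of \<open>w\<close>.\<close>
  define r where "r = sqrt (sqrt w)"
  have r: "r \<ge> 1" "r ^ 4 = w"
  proof -
    show "r \<ge> 1" using assms by (simp add: r_def)
    have "r ^ 4 = (r\<^sup>2)\<^sup>2" by simp
    also have "\<dots> = w" unfolding r_def using assms by simp
    finally show "r ^ 4 = w" .
  qed
  have "ln w = 4 * ln r" unfolding r(2)[symmetric] using r(1) by (simp add: ln_realpow)
  moreover have "0 \<le> ln r" "ln r \<le> r" using r(1) ln_le_minus_one[of r] by auto
  ultimately have "(ln w)\<^sup>2 \<le> 16 * r\<^sup>2"
    by (simp add: power_mult_distrib power_mono)
  then have "B * (ln w)\<^sup>2 \<le> B * (16 * r\<^sup>2)" using assms by (intro mult_left_mono) auto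
  also have "\<dots> \<le> (r\<^sup>2)\<^sup>2 / 2 + 128 * B\<^sup>2"
    using zero_le_power2[of "r\<^sup>2 - 16 * B"] by (simp add: power2_diff power_mult_distrib mult_ac)
  finally show ?thesis using r(2) by simp
qed

text \<open>Passing from \<open>\<bar>Im z\<bar>\<close> to \<open>\<bar>z\<bar>\<close>: either the imaginary part is at least \<open>\<bar>z\<bar> / 2\<close>, and the
  logarithms differ by \<open>ln 2\<close>, or the real part dominates; then it is negative and beats the
  squared logarithm by itself, or \<open>z\<close> ranges over a bounded set.\<close>

lemma Re_le_ln_cmod:
  assumes H: "\<And>b. b > 0 \<Longrightarrow> \<exists>a. \<forall>z\<in>\<sigma>. Re z \<le> a - b * L \<bar>Im z\<bar>" and B: "B > 0"
  obtains a where "\<And>z. z \<in> \<sigma> \<Longrightarrow> 1 \<le> cmod z \<Longrightarrow> Re z \<le> a - B * (ln (cmod z))\<^sup>2"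
proof -
  obtain a where a: "\<And>z. z \<in> \<sigma> \<Longrightarrow> Re z \<le> a - 2 * B * L \<bar>Im z\<bar>"
    using H[of "2 * B"] B by auto
  let ?a = "\<bar>a\<bar> + 2 * (B * (ln 2)\<^sup>2) + B * (ln (2 * \<bar>a\<bar> + 1))\<^sup>2 + 128 * B\<^sup>2"
  have Lge: "0 \<le> L x" for x by (simp add: L_def)
  have nn: "0 \<le> B * (ln 2)\<^sup>2" "0 \<le> B * (ln (2 * \<bar>a\<bar> + 1))\<^sup>2" "0 \<le> 128 * B\<^sup>2" using B by auto
  have "Re z \<le> ?a - B * (ln (cmod z))\<^sup>2" if z: "z \<in> \<sigma>" "1 \<le> cmod z" for z
  proof -
    define w y where "w = cmod z" and "y = \<bar>Im z\<bar>"
    have w: "w \<ge> 1" "w \<le> \<bar>Re z\<bar> + y" using z cmod_le[of z] by (auto simp: w_def y_def)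
    have Re_a: "Re z \<le> a"
      using a[OF z(1)] mult_nonneg_nonneg[OF less_imp_le[OF B] Lge[of "\<bar>Im z\<bar>"]] by simp
    consider "y \<ge> w / 2" "y \<ge> 1" | "y \<ge> w / 2" "y < 1" | "\<bar>Re z\<bar> \<ge> w / 2" "Re z \<ge> 0"
      | "\<bar>Re z\<bar> \<ge> w / 2" "Re z < 0" using w by linarith
    then show ?thesis
    proof cases
      case 1
      have "ln w \<le> ln (2 * y)" using 1 w by simp
      also have "\<dots> = ln 2 + ln y" using 1 by (simp add: ln_mult)
      finally have "(ln w)\<^sup>2 \<le> (ln 2 + ln y)\<^sup>2" using w by (intro power_mono) auto
      also have "\<dots> \<le> 2 * (ln 2)\<^sup>2 + 2 * (ln y)\<^sup>2"
        using zero_le_power2[of "ln 2 - ln y"] by (simp add: power2_sum power2_diff)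
      finally have "B * (ln w)\<^sup>2 \<le> B * (2 * (ln 2)\<^sup>2 + 2 * (ln y)\<^sup>2)"
        using B by (intro mult_left_mono) auto
      also have "\<dots> = 2 * (B * (ln 2)\<^sup>2) + 2 * (B * (ln y)\<^sup>2)" by (simp add: algebra_simps)
      finally have "B * (ln w)\<^sup>2 \<le> 2 * (B * (ln 2)\<^sup>2) + 2 * (B * (ln y)\<^sup>2)" .
      moreover have "Re z \<le> a - 2 * (B * (ln y)\<^sup>2)" using a[OF z(1)] 1 by (simp add: L_def y_def)
      ultimately show ?thesis using nn abs_ge_self[of a] unfolding w_def[symmetric] by linarith
    next
      case 2
      have "ln w \<le> ln 2" using 2 w by simp
      then have "B * (ln w)\<^sup>2 \<le> B * (ln 2)\<^sup>2" using w B by (intro mult_left_mono power_mono) auto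
      then show ?thesis using nn abs_ge_self[of a] Re_a unfolding w_def[symmetric] by linarith
    next
      case 3
      then have "w \<le> 2 * \<bar>a\<bar> + 1" using Re_a by linarith
      then have "ln w \<le> ln (2 * \<bar>a\<bar> + 1)" using w by simp
      then have "B * (ln w)\<^sup>2 \<le> B * (ln (2 * \<bar>a\<bar> + 1))\<^sup>2"
        using w B by (intro mult_left_mono power_mono) auto
      then show ?thesis using nn abs_ge_self[of a] Re_a unfolding w_def[symmetric] by linarith
    next
      case 4
      then have "Re z \<le> - w / 2" by linarith
      then show ?thesis using ln_squared_le[OF w(1) B] nn abs_ge_zero[of a] unfolding w_def[symmetric] by linarith
    qed
  qed
  then show ?thesis by (rule that)
qed

text \<open>With \<open>l = ln \<bar>z\<bar>\<close> and \<open>k = ln \<alpha>\<close> the claim for \<open>\<bar>z\<bar> \<ge> 1\<close> is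
  \<open>n l - l\<^sup>2 \<le> n\<^sup>2 + n k + const\<close>, because \<open>t Re z \<le> const - l\<^sup>2\<close> when the constant in front of the
  squared logarithm is \<open>1 / p\<close> and \<open>t \<ge> p\<close>.\<close>

lemma power_exp_spectral_growth:
  assumes H: "\<And>b. b > 0 \<Longrightarrow> \<exists>a. \<forall>z\<in>\<sigma>. Re z \<le> a - b * L \<bar>Im z\<bar>"
    and p: "0 < p" and \<alpha>: "0 < \<alpha>"
  obtains C where "C > 0" "\<And>n t z. t \<in> {p..q} \<Longrightarrow> z \<in> \<sigma> \<Longrightarrow>
      cmod z ^ n * exp (t * Re z) \<le> C * \<alpha> ^ n * exp ((real n)\<^sup>2)"
proof -
  obtain a where a: "\<And>z. z \<in> \<sigma> \<Longrightarrow> 1 \<le> cmod z \<Longrightarrow> Re z \<le> a - 1 / p * (ln (cmod z))\<^sup>2"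
    using Re_le_ln_cmod[where \<sigma> = \<sigma> and B = "1 / p", OF H] p by auto
  define k where "k = ln \<alpha>"
  \<comment> \<open>The first summand bounds \<open>t Re z\<close> in both cases below; \<open>k\<^sup>2\<close> pays for a negative \<open>n k\<close>.\<close>
  define C where "C = exp (q * (1 + \<bar>a\<bar>) + k\<^sup>2)"
  have rhs: "C * \<alpha> ^ n * exp ((real n)\<^sup>2) = exp (q * (1 + \<bar>a\<bar>) + k\<^sup>2 + real n * k + (real n)\<^sup>2)" for n
    using \<alpha> by (simp add: C_def k_def exp_add exp_of_nat_mult)
  have "cmod z ^ n * exp (t * Re z) \<le> C * \<alpha> ^ n * exp ((real n)\<^sup>2)"
    if t: "t \<in> {p..q}" and z: "z \<in> \<sigma>" for n t z
  proof (cases "cmod z < 1")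
    case True
    have tq: "0 < t" "t \<le> q" using t p by auto
    have "Re z \<le> 1 + \<bar>a\<bar>" using True abs_Re_le_cmod[of z] by linarith
    then have "t * Re z \<le> t * (1 + \<bar>a\<bar>)" using tq by (intro mult_left_mono) auto
    also have "\<dots> \<le> q * (1 + \<bar>a\<bar>)" using tq by (intro mult_right_mono) auto
    finally have "t * Re z \<le> q * (1 + \<bar>a\<bar>)" .
    moreover have "0 \<le> k\<^sup>2 + real n * k + (real n)\<^sup>2"
      using zero_le_power2[of "real n + k"] zero_le_power2[of "real n"] zero_le_power2[of k]
      unfolding power2_sum by linarith
    ultimately have "exp (t * Re z) \<le> C * \<alpha> ^ n * exp ((real n)\<^sup>2)" unfolding rhs by simp
    moreover have "cmod z ^ n \<le> 1" using True by (intro power_le_one) auto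
    then have "cmod z ^ n * exp (t * Re z) \<le> exp (t * Re z)" by (simp add: mult_left_le_one_le)
    ultimately show ?thesis by (rule order_trans[rotated])
  next
    case False
    define l where "l = ln (cmod z)"
    have tq: "0 < t" "t \<le> q" using t p by auto
    have "0 < cmod z" using False by linarith
    then have "cmod z ^ n = exp (real n * l)" by (simp add: l_def exp_of_nat_mult)
    then have lhs: "cmod z ^ n * exp (t * Re z) = exp (real n * l + t * Re z)" by (simp add: exp_add)
    have "t * Re z \<le> t * (\<bar>a\<bar> - 1 / p * l\<^sup>2)"
      using a[OF z] False tq unfolding l_def by (intro mult_left_mono) auto
    also have "\<dots> = t * \<bar>a\<bar> - t / p * l\<^sup>2" by (simp add: algebra_simps)
    also have "\<dots> \<le> q * (1 + \<bar>a\<bar>) - 1 * l\<^sup>2"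
    proof (rule diff_mono)
      show "t * \<bar>a\<bar> \<le> q * (1 + \<bar>a\<bar>)" using tq by (intro mult_mono) auto
      show "1 * l\<^sup>2 \<le> t / p * l\<^sup>2" using t p by (intro mult_right_mono) auto
    qed
    finally have "t * Re z \<le> q * (1 + \<bar>a\<bar>) - l\<^sup>2" by simp
    moreover have "real n * l \<le> k\<^sup>2 + real n * k + (real n)\<^sup>2 + l\<^sup>2"
    proof -
      have "0 \<le> (2 * real n - (l - k))\<^sup>2" by simp
      then have "4 * (real n * (l - k)) \<le> 4 * (real n)\<^sup>2 + (l - k)\<^sup>2"
        by (simp add: power2_eq_square algebra_simps)
      moreover have "(l - k)\<^sup>2 \<le> 2 * l\<^sup>2 + 2 * k\<^sup>2"
        using zero_le_power2[of "l + k"] unfolding power2_diff power2_sum by linarith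
      ultimately have "4 * (real n * (l - k)) \<le> 4 * (real n)\<^sup>2 + 4 * l\<^sup>2 + 4 * k\<^sup>2"
        using zero_le_power2[of l] zero_le_power2[of k] by linarith
      then show ?thesis by (simp add: right_diff_distrib)
    qed
    ultimately show ?thesis unfolding rhs lhs by simp
  qed
  then show ?thesis by (intro that[of C]) (auto simp: C_def)
qed

text \<open>The exponent \<open>n\<^sup>2 - n l\<close> is smallest at \<open>n = l / 2\<close>; rounding \<open>l / 2\<close> down to an integer
  costs at most 1.  The resulting factor \<open>1 / (4 t)\<close> equals \<open>b\<close> for \<open>t = 1 / (4 b)\<close>.\<close>

lemma Re_le_of_power_exp_growth:
  assumes b: "b > 0"
    and growth: "\<And>t. t > 0 \<Longrightarrow> \<exists>C. \<forall>n. \<forall>z\<in>\<sigma>. cmod z ^ n * exp (t * Re z) \<le> C * exp ((real n)\<^sup>2)"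
  shows "\<exists>a. \<forall>z\<in>\<sigma>. Re z \<le> a - b * L \<bar>Im z\<bar>"
proof -
  define t where "t = 1 / (4 * b)"
  have t: "t > 0" using b by (simp add: t_def)
  obtain C' where C': "\<And>n z. z \<in> \<sigma> \<Longrightarrow> cmod z ^ n * exp (t * Re z) \<le> C' * exp ((real n)\<^sup>2)"
    using growth[OF t] by blast
  define C where "C = max C' 1"
  have C: "C \<ge> 1" by (simp add: C_def)
  have gr: "cmod z ^ n * exp (t * Re z) \<le> exp (ln C + (real n)\<^sup>2)" if "z \<in> \<sigma>" for n z
  proof -
    have "C' * exp ((real n)\<^sup>2) \<le> C * exp ((real n)\<^sup>2)" by (intro mult_right_mono) (auto simp: C_def)
    from order_trans[OF C'[OF that] this] show ?thesis using C by (simp add: exp_add)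
  qed
  have "Re z \<le> (ln C + 1) / t - b * L \<bar>Im z\<bar>" if z: "z \<in> \<sigma>" for z
  proof (cases "\<bar>Im z\<bar> < 1")
    case True
    have "t * Re z \<le> ln C" using gr[OF z, of 0] by simp
    then have "t * Re z \<le> ln C + 1" by simp
    then show ?thesis using True t by (simp add: L_def field_simps)
  next
    case False
    define l where "l = ln (cmod z)"
    have w: "\<bar>Im z\<bar> \<le> cmod z" "1 \<le> cmod z" using abs_Im_le_cmod[of z] False by linarith+
    then have "0 < \<bar>Im z\<bar>" "0 < cmod z" using False by linarith+
    then have l: "0 \<le> l" "ln \<bar>Im z\<bar> \<le> l" using w by (simp_all add: l_def)
    \<comment> \<open>The minimiser of \<open>n\<^sup>2 - n l\<close>, rounded; \<open>\<theta>\<close> is the rounding error.\<close>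
    define n where "n = nat \<lfloor>l / 2\<rfloor>"
    define \<theta> where "\<theta> = l / 2 - real n"
    have \<theta>: "0 \<le> \<theta>" "\<theta> \<le> 1" using l(1) by (auto simp: \<theta>_def n_def) linarith+
    have "cmod z ^ n = exp (real n * l)"
      using \<open>0 < cmod z\<close> by (simp add: l_def exp_of_nat_mult)
    then have "exp (real n * l + t * Re z) \<le> exp (ln C + (real n)\<^sup>2)"
      using gr[OF z, of n] by (simp add: exp_add)
    then have "t * Re z \<le> ln C + (real n)\<^sup>2 - real n * l" by simp
    also have "(real n)\<^sup>2 - real n * l = \<theta>\<^sup>2 - l\<^sup>2 / 4"
      by (simp add: \<theta>_def power2_eq_square field_simps)
    then have "ln C + (real n)\<^sup>2 - real n * l = ln C + \<theta>\<^sup>2 - l\<^sup>2 / 4" by simp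
    also have "\<dots> \<le> ln C + 1 - L \<bar>Im z\<bar> / 4"
    proof -
      have "\<theta>\<^sup>2 \<le> 1" using \<theta> by (simp add: power_le_one)
      moreover have "L \<bar>Im z\<bar> \<le> l\<^sup>2" using l False by (simp add: L_def power_mono)
      ultimately show ?thesis by simp
    qed
    finally have "t * Re z \<le> ln C + 1 - L \<bar>Im z\<bar> / 4" .
    then have "Re z \<le> (ln C + 1 - L \<bar>Im z\<bar> / 4) / t" using t by (simp add: pos_le_divide_eq mult.commute)
    also have "\<dots> = (ln C + 1) / t - b * L \<bar>Im z\<bar>" using b by (simp add: t_def algebra_simps)
    finally show ?thesis .
  qed
  then show ?thesis by blast
qed

section \<open>The semigroup of exponentials\<close>

context spectral_operator
begin

definition exp_semigroup :: "real \<Rightarrow> 'a \<Rightarrow> 'a" where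
  "exp_semigroup t = \<Phi> (\<lambda>z. exp (t *\<^sub>R z) * indicator (spectrum A) z)"

context
  fixes a0 :: real
  assumes a0: "0 \<le> a0" and Re_le: "\<And>z. z \<in> spectrum A \<Longrightarrow> Re z \<le> a0"
begin

lemma exp_bound:
  assumes "0 \<le> t" "t \<le> b"
  shows "cmod (exp (t *\<^sub>R z) * indicator (spectrum A) z) \<le> exp (b * a0)"
proof (cases "z \<in> spectrum A")
  case True
  have "t * Re z \<le> t * a0" using assms Re_le[OF True] by (intro mult_left_mono)
  also have "\<dots> \<le> b * a0" using assms a0 by (intro mult_right_mono)
  finally show ?thesis using True by (simp add: norm_mult)
qed simp

lemma exp_borel: "(\<lambda>z. exp (t *\<^sub>R z) * indicator (spectrum A) z :: complex) \<in> borel_measurable borel"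
  by measurable

lemma exp_bounded_borel:
  "0 \<le> t \<Longrightarrow> bounded_borel (\<lambda>z. exp (t *\<^sub>R z) * indicator (spectrum A) z)"
  by (rule bounded_borelI[OF exp_borel exp_bound[of t t]]) auto

lemma C0_exp_semigroup: "C0_semigroup exp_semigroup"
  unfolding C0_semigroup_def
proof (intro conjI allI impI)
  fix s t :: real
  assume t: "0 \<le> t"
  show "bounded_clinear (exp_semigroup t)"
    unfolding exp_semigroup_def by (intro bounded_integral_clinear exp_bounded_borel t)
  assume s: "0 \<le> s"
  show "exp_semigroup (s + t) = exp_semigroup s \<circ> exp_semigroup t"
  proof -
    have "(\<lambda>z. exp ((s + t) *\<^sub>R z) * indicator (spectrum A) z) = (\<lambda>z.
        exp (s *\<^sub>R z) * indicator (spectrum A) z * (exp (t *\<^sub>R z) * indicator (spectrum A) z :: complex))"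
      by (auto simp: fun_eq_iff scaleR_add_left exp_add indicator_def)
    then have "exp_semigroup (s + t) f = exp_semigroup s (exp_semigroup t f)" for f
      using bounded_integral_mult[OF exp_bounded_borel[OF s] exp_bounded_borel[OF t], of f]
      by (simp only: exp_semigroup_def)
    then show ?thesis by (simp add: fun_eq_iff)
  qed
next
  show "exp_semigroup 0 = id"
    by (simp add: exp_semigroup_def fun_eq_iff bounded_integral_indicator E_spectrum)
next
  fix f
  show "continuous_on {0..} (\<lambda>t. exp_semigroup t f)"
    unfolding continuous_on_def
  proof
    fix t0 :: real assume t0: "t0 \<in> {0..}"
    have "((\<lambda>t. exp_semigroup t f) \<longlongrightarrow> exp_semigroup t0 f) (at t0 within {0..t0 + 1})"
      unfolding exp_semigroup_def
    proof (rule bounded_integral_dominated_within[where c = "exp ((t0 + 1) * a0)"])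
      fix z :: complex
      show "((\<lambda>t. exp (t *\<^sub>R z) * indicator (spectrum A) z) \<longlongrightarrow> exp (t0 *\<^sub>R z) * indicator (spectrum A) z)
          (at t0 within {0..t0 + 1})"
        by (intro tendsto_intros)
    qed (use exp_bound exp_borel in auto)
    moreover have "at t0 within {0..} = at t0 within {0..t0 + 1}"
      by (rule at_within_nhd[of _ "{..<t0 + 1}"]) auto
    ultimately show "((\<lambda>t. exp_semigroup t f) \<longlongrightarrow> exp_semigroup t0 f) (at t0 within {0..})" by simp
  qed
qed

lemma E_K_exp_semigroup:
  assumes "0 \<le> t"
  shows "E (K n) (exp_semigroup t f) = \<Phi> (\<lambda>z. exp (t *\<^sub>R z) * indicator (K n) z) f"
proof -
  have "(\<lambda>z. exp (t *\<^sub>R z) * indicator (spectrum A) z * indicator (K n) z)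
      = (\<lambda>z. exp (t *\<^sub>R z) * indicator (K n) z :: complex)"
    by (auto simp: indicator_def K_def fun_eq_iff)
  then show ?thesis
    using assms by (simp add: exp_semigroup_def bounded_integral_E_commute exp_bounded_borel)
qed

text \<open>Cutting down to \<open>K n\<close> identifies the generator inside \<open>A\<close>.  For the other inclusion the
  difference quotient at \<open>f\<close> is \<open>\<Phi> (G t) g\<close> with \<open>G t z = (e\<^sup>t\<^sup>z - 1) / (t z)\<close>, which is bounded on
  the spectrum uniformly in \<open>t \<le> 1\<close> and tends to 1.\<close>

lemma generator_exp_semigroup: "generator exp_semigroup = A"
proof (intro set_eqI iffI; clarify)
  fix f g assume "(f, g) \<in> generator exp_semigroup"
  then have lim: "((\<lambda>t. (exp_semigroup t f - f) /\<^sub>R t) \<longlongrightarrow> g) (at_right 0)"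
    by (simp add: generator_def)
  show "(f, g) \<in> A"
    unfolding mem_operator_iff
  proof
    fix n
    let ?D = "\<lambda>t. (\<Phi> (\<lambda>z. exp (t *\<^sub>R z) * indicator (K n) z) f - E (K n) f) /\<^sub>R t"
    interpret EK: bounded_linear "E (K n)" by (rule E_bounded_linear) simp
    have "((\<lambda>t. E (K n) ((exp_semigroup t f - f) /\<^sub>R t)) \<longlongrightarrow> E (K n) g) (at_right 0)"
      by (rule EK.tendsto[OF lim])
    moreover have "\<forall>\<^sub>F t in at_right 0. E (K n) ((exp_semigroup t f - f) /\<^sub>R t) = ?D t"
      by (auto simp: eventually_at_filter EK.scaleR EK.diff E_K_exp_semigroup)
    ultimately have 1: "(?D \<longlongrightarrow> E (K n) g) (at_right 0)"
      by (rule Lim_transform_eventually)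
    have "(?D \<longlongrightarrow> \<Phi> (\<lambda>z. z * indicator (K n) z) f) (at 0)"
      using cut_power_exp_has_vector_derivative[of 0 n f 0]
      by (simp add: has_vector_derivative_iff_tendsto bounded_integral_indicator)
    then have "(?D \<longlongrightarrow> \<Phi> (\<lambda>z. z * indicator (K n) z) f) (at_right 0)"
      by (rule tendsto_mono[rotated]) (simp add: at_le)
    with 1 show "E (K n) g = \<Phi> (\<lambda>z. z * indicator (K n) z) f"
      by (rule tendsto_unique[rotated]) simp
  qed
next
  fix f g assume fg: "(f, g) \<in> A"
  \<comment> \<open>The value 1 at \<open>z = 0\<close> is the removable singularity.\<close>
  define G where "G t z = (if z = 0 then 1 else (exp (t *\<^sub>R z) - 1) / (t *\<^sub>R z)) * indicator (spectrum A) z"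
    for t :: real and z :: complex
  have mG: "G t \<in> borel_measurable borel" for t
    unfolding G_def by measurable
  have cG: "cmod (G t z) \<le> exp a0" if t: "t \<in> {0<..1}" for t z
  proof (cases "z \<in> spectrum A \<and> z \<noteq> 0")
    case True
    have "cmod (exp (t *\<^sub>R z) - exp (0 *\<^sub>R z)) \<le> (exp a0 * cmod z) * \<bar>t - 0\<bar>"
    proof (rule vector_derivative_lipschitz[where T = "{0..1}"])
      fix u :: real assume u: "u \<in> {0..1}"
      show "((\<lambda>t. exp (t *\<^sub>R z)) has_vector_derivative exp (u *\<^sub>R z) * z) (at u within {0..1})"
        by (rule exp_scaleR_has_vector_derivative_right)
      show "cmod (exp (u *\<^sub>R z) * z) \<le> exp a0 * cmod z"
        using exp_bound[of u 1 z] u True by (simp add: norm_mult mult_right_mono)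
    qed (use t in auto)
    then show ?thesis
      using True t by (simp add: G_def norm_divide norm_mult field_simps)
  next
    case False
    then show ?thesis using a0 by (auto simp: G_def indicator_def)
  qed
  have bG: "bounded_borel (G t)" if "t \<in> {0<..1}" for t
    using mG cG[OF that] by (rule bounded_borelI)
  have eq: "(exp_semigroup t f - f) /\<^sub>R t = \<Phi> (G t) g" if t: "t \<in> {0<..1}" for t
  proof (rule E_K_eqI)
    fix n
    interpret EK: bounded_linear "E (K n)" by (rule E_bounded_linear) simp
    have "E (K n) (\<Phi> (G t) g) = \<Phi> (G t) (\<Phi> (\<lambda>z. z * indicator (K n) z) f)"
      using fg t bG by (simp add: bounded_integral_E_commute mem_operator_iff[symmetric] flip: bounded_integral_E_commute(2))
        (simp add: mem_operator_iff)
    also have "\<dots> = \<Phi> (\<lambda>z. G t z * (z * indicator (K n) z)) f"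
      using t by (intro bounded_integral_mult[symmetric] bG bounded_borel_cut continuous_intros)
    also have "(\<lambda>z. G t z * (z * indicator (K n) z))
        = (\<lambda>z. complex_of_real (inverse t) * (exp (t *\<^sub>R z) * indicator (K n) z - indicator (K n) z))"
      using t by (auto simp: G_def K_def indicator_def fun_eq_iff scaleR_conv_of_real field_simps)
    also have "\<Phi> \<dots> f = (\<Phi> (\<lambda>z. exp (t *\<^sub>R z) * indicator (K n) z) f - E (K n) f) /\<^sub>R t"
    proof -
      have "bounded_borel (\<lambda>z. exp (t *\<^sub>R z) * indicator (K n) z)"
        by (intro bounded_borel_cut continuous_intros)
      moreover have "bounded_borel (indicator (K n))" by (intro bounded_borel_indicator K_borel)
      ultimately show ?thesis
        by (simp only: bounded_integral_cmult bounded_borel_minus bounded_integral_diff scaleC_of_real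
            bounded_integral_indicator K_borel)
    qed
    also have "\<dots> = E (K n) ((exp_semigroup t f - f) /\<^sub>R t)"
      using t by (simp add: EK.scaleR EK.diff E_K_exp_semigroup)
    finally show "E (K n) ((exp_semigroup t f - f) /\<^sub>R t) = E (K n) (\<Phi> (G t) g)" by simp
  qed
  have at0: "at_right (0::real) = at 0 within {0<..1}"
    by (rule at_within_nhd[of _ "{..<1}"]) auto
  have "((\<lambda>t. \<Phi> (G t) g) \<longlongrightarrow> \<Phi> (indicator (spectrum A)) g) (at 0 within {0<..1})"
  proof (rule bounded_integral_dominated_within[where c = "exp a0"])
    fix z :: complex
    show "((\<lambda>t. G t z) \<longlongrightarrow> indicator (spectrum A) z) (at 0 within {0<..1})"
    proof (cases "z = 0")
      case False
      have "((\<lambda>t. (exp (t *\<^sub>R z) - 1) /\<^sub>R t) \<longlongrightarrow> z) (at 0 within {0<..1})"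
        using exp_scaleR_has_vector_derivative_right[of z 0 "{0<..1}"]
        by (simp add: has_vector_derivative_iff_tendsto)
      then have "((\<lambda>t. ((exp (t *\<^sub>R z) - 1) /\<^sub>R t) / z * indicator (spectrum A) z) \<longlongrightarrow>
          z / z * indicator (spectrum A) z) (at 0 within {0<..1})"
        using False by (intro tendsto_intros)
      then show ?thesis using False by (simp add: G_def scaleR_conv_of_real field_simps)
    qed (simp add: G_def)
  qed (use mG cG in auto)
  then have "((\<lambda>t. \<Phi> (G t) g) \<longlongrightarrow> g) (at_right 0)"
    by (simp add: at0 bounded_integral_indicator E_spectrum)
  moreover have "\<forall>\<^sub>F t in at_right 0. \<Phi> (G t) g = (exp_semigroup t f - f) /\<^sub>R t"
    unfolding at0 by (auto simp: eventually_at_filter eq)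
  ultimately have "((\<lambda>t. (exp_semigroup t f - f) /\<^sub>R t) \<longlongrightarrow> g) (at_right 0)"
    by (rule Lim_transform_eventually)
  then show "(f, g) \<in> generator exp_semigroup" by (simp add: generator_def)
qed

end

text \<open>Differentiation under the integral gives the derivatives \<open>\<Phi> (z\<^sup>n e\<^sup>t\<^sup>z 1\<^sub>\<sigma>) f\<close>, whose norms are
  controlled by the supremum of the integrand.\<close>

lemma beurling_carleman_exp_semigroup:
  assumes m: "\<And>n. 0 \<le> m n"
    and growth: "\<And>p q \<alpha>. 0 < p \<Longrightarrow> 0 < \<alpha> \<Longrightarrow> \<exists>C>0. \<forall>n. \<forall>t\<in>{p..q}. \<forall>z\<in>spectrum A.
      cmod z ^ n * exp (t * Re z) \<le> C * \<alpha> ^ n * m n"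
  shows "beurling_carleman_on m (\<lambda>t. exp_semigroup t f) {0<..}"
proof -
  define D where "D n t = \<Phi> (\<lambda>z. z ^ n * exp (t *\<^sub>R z) * indicator (spectrum A) z) f" for n t
  have D_deriv: "(D n has_vector_derivative D (Suc n) t) (at t)" if t: "t > 0" for n t
  proof -
    obtain C where "\<forall>n. \<forall>s\<in>{t / 2..2 * t}. \<forall>z\<in>spectrum A. cmod z ^ n * exp (s * Re z) \<le> C * 1 ^ n * m n"
      using growth[of "t / 2" 1 "2 * t"] t by (meson half_gt_zero zero_less_one)
    then have C: "cmod z ^ n * exp (s * Re z) \<le> C * 1 ^ n * m n"
      if "s \<in> {t / 2..2 * t}" "z \<in> spectrum A" for n s z using that by blast
    show ?thesis
      unfolding D_def
      by (rule power_exp_integral_has_vector_derivative[where p = "t / 2" and q = "2 * t", OF _ _ C C])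
        (use t in auto)
  qed
  have nth: "nth_derivative n (\<lambda>t. exp_semigroup t f) t = D n t" if "t > 0" for n t
    using that
  proof (induction n arbitrary: t)
    case 0
    then show ?case by (simp add: nth_derivative_def D_def exp_semigroup_def)
  next
    case (Suc n)
    have "(nth_derivative n (\<lambda>t. exp_semigroup t f) has_vector_derivative D (Suc n) t) (at t)"
      by (rule has_vector_derivative_transform_within_open[OF D_deriv[OF Suc.prems], of "{0<..}"])
        (use Suc in auto)
    then have "vector_derivative (nth_derivative n (\<lambda>t. exp_semigroup t f)) (at t) = D (Suc n) t"
      by (rule vector_derivative_at)
    then show ?case by (simp add: nth_derivative_def)
  qed
  have diff: "nth_derivative n (\<lambda>t. exp_semigroup t f) differentiable (at t)" if "t > 0" for n t
  proof -
    have "(nth_derivative n (\<lambda>t. exp_semigroup t f) has_vector_derivative D (Suc n) t) (at t)"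
      by (rule has_vector_derivative_transform_within_open[OF D_deriv[OF that], of "{0<..}"])
        (use that nth in auto)
    then show ?thesis by (auto simp: has_vector_derivative_def differentiable_def)
  qed
  show ?thesis
    unfolding beurling_carleman_on_def infinitely_differentiable_on_def
  proof (intro conjI allI impI ballI)
    fix a b \<alpha> :: real assume ab: "a \<le> b \<and> {a..b} \<subseteq> {0<..}" and \<alpha>: "0 < \<alpha>"
    then have a: "0 < a" by auto
    obtain C where C: "C > 0" "\<And>n t z. t \<in> {a..b} \<Longrightarrow> z \<in> spectrum A \<Longrightarrow>
        cmod z ^ n * exp (t * Re z) \<le> C * \<alpha> ^ n * m n"
      using growth[OF a \<alpha>, of b] by blast
    let ?c = "C * (4 * M * norm f) + 1"
    have "norm (nth_derivative n (\<lambda>t. exp_semigroup t f) t) \<le> ?c * \<alpha> ^ n * m n" if t: "t \<in> {a..b}" for n t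
    proof -
      have pos: "0 \<le> \<alpha> ^ n * m n" using \<alpha> m by simp
      have "norm (D n t) \<le> (C * \<alpha> ^ n * m n) * (4 * M * norm f)"
        unfolding D_def
      proof (rule bounded_integral_norm_le)
        show "cmod (z ^ n * exp (t *\<^sub>R z) * indicator (spectrum A) z) \<le> C * \<alpha> ^ n * m n" for z
          using C(2)[OF t, of z n] C(1) m[of n] \<alpha> by (simp add: indicator_def norm_mult norm_power)
      qed measurable
      also have "\<dots> \<le> ?c * \<alpha> ^ n * m n" using pos by (simp add: algebra_simps)
      finally show ?thesis using nth[of t n] t a by simp
    qed
    moreover have "?c > 0" using C(1) M_nonneg by (intro add_nonneg_pos) auto
    ultimately show "\<exists>c>0. \<forall>n. \<forall>t\<in>{a..b}.
        norm (nth_derivative n (\<lambda>t. exp_semigroup t f) t) \<le> c * \<alpha> ^ n * m n" by blast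
  qed (use diff in auto)
qed

end

section \<open>Orbits of a semigroup with smooth orbits\<close>

context spectral_operator
begin

context
  fixes S :: "real \<Rightarrow> 'a \<Rightarrow> 'a"
  assumes S: "C0_semigroup S" and gen: "generator S = A"
    and smooth: "\<And>f. infinitely_differentiable_on (\<lambda>t. S t f) {0<..}"
begin

text \<open>A derivative of the orbit at \<open>t\<close> is in particular a right derivative, hence a value of the
  generator at \<open>S t f\<close>.\<close>

lemma orbit_solves:
  assumes "t > 0"
  obtains g where "((\<lambda>t. S t f) has_vector_derivative g) (at t)" "(S t f, g) \<in> A"
proof -
  have "nth_derivative 0 (\<lambda>t. S t f) differentiable (at t)"
    using smooth[of f] assms unfolding infinitely_differentiable_on_def by blast
  then have "(\<lambda>t. S t f) differentiable (at t)" by (simp add: nth_derivative_def)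
  then obtain g where g: "((\<lambda>t. S t f) has_vector_derivative g) (at t)"
    using vector_derivative_works by blast
  have "((\<lambda>y. (S y f - S t f) /\<^sub>R (y - t)) \<longlongrightarrow> g) (at_right t)"
    using has_vector_derivative_at_within[OF g] by (simp add: has_vector_derivative_iff_tendsto)
  then have "((\<lambda>h. (S (h + t) f - S t f) /\<^sub>R h) \<longlongrightarrow> g) (at_right 0)"
    by (subst (asm) filterlim_at_right_to_0) simp
  moreover have "\<forall>\<^sub>F h in at_right 0. (S (h + t) f - S t f) /\<^sub>R h = (S h (S t f) - S t f) /\<^sub>R h"
    using S assms by (auto simp: C0_semigroup_def eventually_at_filter)
  ultimately have "((\<lambda>h. (S h (S t f) - S t f) /\<^sub>R h) \<longlongrightarrow> g) (at_right 0)"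
    by (rule Lim_transform_eventually)
  then have "(S t f, g) \<in> generator S" by (simp add: generator_def)
  then show ?thesis using that g gen by simp
qed

text \<open>The function \<open>t \<mapsto> \<Phi> (e\<^bsup>(T - t) z\<^esup> 1\<^bsub>K m\<^esub>) (S t f)\<close> has derivative 0 on \<open>(0, T]\<close>, because the
  orbit solves the Cauchy problem for \<open>A\<close> and \<open>A\<close> acts on \<open>K m\<close> as multiplication by \<open>z\<close>.  Its
  values at \<open>0\<close> and \<open>T\<close> are the two sides of the claim.\<close>

lemma E_K_orbit:
  assumes T: "T > 0"
  shows "E (K m) (S T f) = \<Phi> (\<lambda>z. exp (T *\<^sub>R z) * indicator (K m) z) f"
proof -
  define F where "F t z = exp ((T - t) *\<^sub>R z) * indicator (K m) z" for t :: real and z :: complex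
  define F' where "F' t z = - (z * F t z)" for t z
  define h where "h t = \<Phi> (F t) (S t f)" for t
  have mF: "F t \<in> borel_measurable borel" for t unfolding F_def by measurable
  have mF': "F' t \<in> borel_measurable borel" for t unfolding F'_def F_def by measurable
  have bF: "cmod (F t z) \<le> exp (T * m)" if t: "t \<in> {0..T}" for t z
  proof (cases "z \<in> K m")
    case True
    have "(T - t) * Re z \<le> (T - t) * \<bar>Re z\<bar>" using t by (intro mult_left_mono) auto
    also have "\<dots> \<le> T * m"
      using True abs_Re_le_cmod[of z] t by (intro mult_mono) (auto simp: K_def)
    finally show ?thesis by (simp add: F_def norm_mult True)
  qed (simp add: F_def)
  have bF': "cmod (F' t z) \<le> m * exp (T * m)" if t: "t \<in> {0..T}" for t z
  proof (cases "z \<in> K m")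
    case True
    then show ?thesis
      using bF[OF t, of z] by (auto simp: F'_def norm_mult K_def intro!: mult_mono)
  qed (simp add: F'_def F_def)
  have derF: "((\<lambda>t. F t z) has_vector_derivative F' t z) (at t within {0..T})" for t z
  proof -
    have "((\<lambda>t. exp ((T - t) *\<^sub>R z)) has_vector_derivative (- 1) *\<^sub>R (exp ((T - t) *\<^sub>R z) * z)) (at t within {0..T})"
    proof -
      have "((\<lambda>t. T - t) has_vector_derivative - 1) (at t within {0..T})"
        by (auto intro!: derivative_eq_intros)
      from vector_diff_chain_within[OF this exp_scaleR_has_vector_derivative_right[of z "T - t"]]
      show ?thesis by (simp add: comp_def)
    qed
    from has_vector_derivative_mult_left[OF this, of "indicator (K m) z"]
    show ?thesis by (simp add: F_def F'_def mult_ac)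
  qed
  have "h T = h 0"
  proof (rule has_derivative_zero_unique_strong_interval[of "{0}" 0 T])
    show "continuous_on {0..T} h"
      unfolding continuous_on_def h_def
    proof
      fix t assume t: "t \<in> {0..T}"
      show "((\<lambda>t. \<Phi> (F t) (S t f)) \<longlongrightarrow> \<Phi> (F t) (S t f)) (at t within {0..T})"
      proof (rule bounded_integral_dominated_within[where c = "exp (T * m)"])
        show "((\<lambda>t. F t z) \<longlongrightarrow> F t z) (at t within {0..T})" for z
          using has_vector_derivative_continuous[OF derF] by (simp add: continuous_within)
        have "continuous_on {0..T} (\<lambda>t. S t f)"
          using S by (auto simp: C0_semigroup_def intro: continuous_on_subset)
        then show "((\<lambda>t. S t f) \<longlongrightarrow> S t f) (at t within {0..T})"
          using t by (simp add: continuous_on_def)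
      qed (use mF bF in auto)
    qed
    fix t assume t: "t \<in> {0..T} - {0}"
    then obtain g where g: "((\<lambda>t. S t f) has_vector_derivative g) (at t)" "(S t f, g) \<in> A"
      using orbit_solves[of t f] by auto
    have bb: "bounded_borel (F t)" by (rule bounded_borelI[OF mF bF]) (use t in auto)
    have "(h has_vector_derivative \<Phi> (F' t) (S t f) + \<Phi> (F t) g) (at t within {0..T})"
      unfolding h_def
      by (rule bounded_integral_has_vector_derivative[where c = "exp (T * m)" and c' = "m * exp (T * m)"])
        (use mF mF' bF bF' derF g t in \<open>auto intro: has_vector_derivative_at_within\<close>)
    moreover have "\<Phi> (F t) g = - \<Phi> (F' t) (S t f)"
    proof -
      have F_K: "(\<lambda>z. F t z * indicator (K m) z) = F t" by (auto simp: F_def indicator_def fun_eq_iff)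
      have "\<Phi> (F t) g = \<Phi> (F t) (E (K m) g)"
        using bounded_integral_E_commute(2)[OF bb K_borel[of m], of g] by (simp add: F_K)
      also have "\<dots> = \<Phi> (F t) (\<Phi> (\<lambda>z. z * indicator (K m) z) (S t f))"
        using g(2) by (simp add: mem_operator_iff)
      also have "\<dots> = \<Phi> (\<lambda>z. F t z * (z * indicator (K m) z)) (S t f)"
        by (intro bounded_integral_mult[symmetric] bb bounded_borel_cut continuous_intros)
      also have "(\<lambda>z. F t z * (z * indicator (K m) z)) = (\<lambda>z. (- 1) * F' t z)"
        by (auto simp: F'_def F_def indicator_def fun_eq_iff)
      also have "\<Phi> (\<lambda>z. (- 1) * F' t z) (S t f) = (- 1) *\<^sub>C \<Phi> (F' t) (S t f)"
        by (intro bounded_integral_cmult bounded_borelI[OF mF' bF']) (use t in auto)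
      also have "\<dots> = - \<Phi> (F' t) (S t f)" by (simp add: scaleC.minus_left)
      finally show ?thesis .
    qed
    ultimately show "(h has_derivative (\<lambda>_. 0)) (at t within {0..T})"
      by (simp add: has_vector_derivative_def)
  qed (use T in auto)
  moreover have "F T = indicator (K m)" by (simp add: F_def fun_eq_iff)
  then have "h T = E (K m) (S T f)" by (simp add: h_def bounded_integral_indicator)
  moreover have "h 0 = \<Phi> (\<lambda>z. exp (T *\<^sub>R z) * indicator (K m) z) f"
    using S by (simp add: h_def F_def[abs_def] C0_semigroup_def)
  ultimately show ?thesis by simp
qed

lemma E_K_nth_derivative:
  assumes "t > 0"
  shows "E (K m) (nth_derivative n (\<lambda>t. S t f) t) = \<Phi> (\<lambda>z. z ^ n * exp (t *\<^sub>R z) * indicator (K m) z) f"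
  using assms
proof (induction n arbitrary: t)
  case 0
  then show ?case by (simp add: nth_derivative_def E_K_orbit)
next
  case (Suc n)
  let ?g = "nth_derivative n (\<lambda>t. S t f)"
  have "?g differentiable (at t)"
    using smooth[of f] Suc.prems unfolding infinitely_differentiable_on_def by blast
  then have "(?g has_vector_derivative nth_derivative (Suc n) (\<lambda>t. S t f) t) (at t)"
    by (simp add: vector_derivative_works nth_derivative_def)
  then have "((\<lambda>t. E (K m) (?g t)) has_vector_derivative E (K m) (nth_derivative (Suc n) (\<lambda>t. S t f) t)) (at t)"
    by (rule bounded_linear.has_vector_derivative[OF E_bounded_linear[OF K_borel]])
  moreover have "((\<lambda>t. E (K m) (?g t)) has_vector_derivative
      \<Phi> (\<lambda>z. z ^ Suc n * exp (t *\<^sub>R z) * indicator (K m) z) f) (at t)"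
    by (rule has_vector_derivative_transform_within_open[OF cut_power_exp_has_vector_derivative, of "{0<..}"])
      (use Suc in auto)
  ultimately show ?case by (rule vector_derivative_unique_at)
qed

text \<open>Cutting down to \<open>K m\<close> turns the \<open>n\<close>-th derivative at \<open>t\<close> into a bounded operator applied
  to \<open>f\<close>.  The resulting family, indexed by \<open>n\<close> and \<open>m\<close> and scaled by \<open>w n\<close>, is pointwise bounded,
  hence bounded in norm by some \<open>C\<close>.  On a vector \<open>f\<close> in the range
  of \<open>E\<close> of a small ball around \<open>z0\<close> this operator is nearly multiplication by the value of the
  integrand at \<open>z0\<close>.\<close>

lemma spectrum_growth:
  assumes t: "t > 0" and w: "\<And>n. 0 < w n"
    and bdd: "\<And>f. \<exists>c. \<forall>n. norm (nth_derivative n (\<lambda>t. S t f) t) \<le> c * w n"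
  obtains C where "\<And>n z. z \<in> spectrum A \<Longrightarrow> cmod z ^ n * exp (t * Re z) \<le> C * w n"
proof -
  let ?H = "\<lambda>n z. z ^ n * exp (t *\<^sub>R z) :: complex"
  define T where "T = (\<lambda>(n, m) f. \<Phi> (\<lambda>z. ?H n z * indicator (K m) z) f /\<^sub>R w n)"
  have bH: "bounded_borel (\<lambda>z. ?H n z * indicator (K m) z)" for n m
    by (intro bounded_borel_cut continuous_intros)
  have lin: "bounded_linear (T p)" for p
    using bounded_linear_scaleR_right bounded_integral_bounded_linear[OF bH]
    by (cases p) (auto simp: T_def intro: bounded_linear_compose[where g = "\<Phi> _"] bounded_linear_const_scaleR)
  have "\<exists>c. \<forall>p\<in>UNIV. norm (T p f) \<le> c" for f
  proof -
    obtain c where c: "\<And>n. norm (nth_derivative n (\<lambda>t. S t f) t) \<le> c * w n" using bdd by blast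
    have "norm (T (n, m) f) \<le> M * c" for n m
    proof -
      have "norm (\<Phi> (\<lambda>z. ?H n z * indicator (K m) z) f) \<le> M * norm (nth_derivative n (\<lambda>t. S t f) t)"
        using E_bound[OF K_borel] E_K_nth_derivative[OF t] by metis
      also have "\<dots> \<le> M * (c * w n)" using c M_nonneg by (intro mult_left_mono) auto
      finally show ?thesis using w[of n] by (simp add: T_def field_simps)
    qed
    then show ?thesis by (auto simp: split_paired_all)
  qed
  then obtain C where C: "\<And>p f. norm (T p f) \<le> C * norm f"
    using uniform_boundedness[of UNIV T] lin by (metis UNIV_I)
  have "cmod (?H n z0) \<le> C * w n" if z0: "z0 \<in> spectrum A" for n z0
  proof (rule field_le_epsilon)
    fix e :: real assume e: "e > 0"
    define \<eta> where "\<eta> = e / (4 * M + 1)"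
    have \<eta>: "\<eta> > 0" "\<eta> * (4 * M) \<le> e"
      using e M_nonneg by (auto simp: \<eta>_def field_simps)
    have "continuous (at z0) (?H n)" by (intro continuous_intros)
    then obtain d where d: "d > 0" "\<And>z. dist z z0 < d \<Longrightarrow> dist (?H n z) (?H n z0) < \<eta>"
      using \<eta>(1) unfolding continuous_at_eps_delta by (metis)
    \<comment> \<open>A radius of at most 1 puts the part of \<open>\<sigma>\<close> in the ball inside \<open>K m\<close> for any \<open>m \<ge> \<bar>z0\<bar> + 1\<close>.\<close>
    define r where "r = min d 1"
    have r: "r > 0" using d by (simp add: r_def)
    obtain f where f: "f \<noteq> 0" "E (ball z0 r) f = f"
      using spectral_projection_ball_nonzero[OF z0 r] by blast
    obtain m :: nat where m: "cmod z0 + 1 \<le> real m" using real_arch_simple by blast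
    let ?I = "indicator (ball z0 r) :: complex \<Rightarrow> complex" and ?J = "indicator (K m) :: complex \<Rightarrow> complex"
    have [measurable]: "ball z0 r \<in> sets borel" by simp
    have Km: "E (K m) f = f"
    proof -
      have "K m \<inter> ball z0 r = spectrum A \<inter> ball z0 r"
      proof -
        have "cmod z \<le> real m" if "dist z0 z < r" for z
          using that m norm_triangle_ineq[of z0 "z - z0"]
          by (simp add: r_def dist_norm norm_minus_commute)
        then show ?thesis by (auto simp: K_def)
      qed
      then have "E (K m) (E (ball z0 r) f) = E (spectrum A) (E (ball z0 r) f)" by (simp add: E_Int)
      then show ?thesis by (simp add: f E_spectrum)
    qed
    have bI: "bounded_borel (\<lambda>z. ?H n z * ?J z * ?I z)"
      by (intro bounded_borel_mult[OF bH] bounded_borel_indicator) simp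
    have "\<Phi> (\<lambda>z. ?H n z * ?J z) f - ?H n z0 *\<^sub>C f
        = \<Phi> (\<lambda>z. ?H n z * ?J z * ?I z - ?H n z0 * (?J z * ?I z)) f"
    proof -
      have bJI: "bounded_borel (\<lambda>z. ?J z * ?I z)"
        by (intro bounded_borel_mult bounded_borel_indicator) auto
      have "\<Phi> (\<lambda>z. ?H n z * ?J z * ?I z) f = \<Phi> (\<lambda>z. ?H n z * ?J z) f"
        using bounded_integral_E_commute(2)[OF bH, of "ball z0 r" n m f] f by simp
      moreover have "\<Phi> (\<lambda>z. ?J z * ?I z) f = f"
        using bounded_integral_E_commute(2)[OF bounded_borel_indicator[OF K_borel], of "ball z0 r" m f] f Km
        by (simp add: bounded_integral_indicator)
      ultimately show ?thesis
        using bJI bI by (simp add: bounded_integral_diff bounded_borel_mult[OF bounded_borel_const] bounded_integral_cmult)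
    qed
    also have "norm \<dots> \<le> \<eta> * (4 * M * norm f)"
    proof (rule bounded_integral_norm_le)
      show "cmod (?H n z * ?J z * ?I z - ?H n z0 * (?J z * ?I z)) \<le> \<eta>" for z
        using d(2)[of z] \<eta>(1) by (auto simp: indicator_def r_def dist_norm norm_minus_commute less_imp_le)
    qed measurable
    also have "\<dots> \<le> e * norm f" using \<eta>(2) by (simp add: mult_right_mono flip: mult.assoc)
    finally have 1: "norm (\<Phi> (\<lambda>z. ?H n z * ?J z) f - ?H n z0 *\<^sub>C f) \<le> e * norm f" .
    have "norm (\<Phi> (\<lambda>z. ?H n z * ?J z) f) / w n \<le> C * norm f"
      using C[of "(n, m)" f] w[of n] by (simp add: T_def divide_inverse mult.commute)
    then have 2: "norm (\<Phi> (\<lambda>z. ?H n z * ?J z) f) \<le> C * w n * norm f"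
      using w[of n] by (simp add: pos_divide_le_eq mult_ac)
    have "cmod (?H n z0) * norm f = norm (?H n z0 *\<^sub>C f)" by (simp add: norm_scaleC)
    also have "\<dots> \<le> norm (\<Phi> (\<lambda>z. ?H n z * ?J z) f) + norm (\<Phi> (\<lambda>z. ?H n z * ?J z) f - ?H n z0 *\<^sub>C f)"
      using norm_triangle_sub[of "?H n z0 *\<^sub>C f" "\<Phi> (\<lambda>z. ?H n z * ?J z) f"]
      by (simp add: norm_minus_commute)
    also have "\<dots> \<le> (C * w n + e) * norm f" using 1 2 by (simp add: algebra_simps)
    finally show "cmod (?H n z0) \<le> C * w n + e" using f(1) by simp
  qed
  then show ?thesis by (intro that[of C]) (simp add: norm_mult norm_power)
qed

end

end

section \<open>The generation criterion\<close>

theorem corollary5p1: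
  fixes A :: "'a::complex_banach operator"
  assumes "scalar_type_spectral A"
  shows "generates_beurling_carleman_semigroup (\<lambda>n. exp ((real n)\<^sup>2)) A \<longleftrightarrow>
    (\<forall>b>0. \<exists>a::real. \<forall>z\<in>spectrum A. Re z \<le> a - b * L \<bar>Im z\<bar>)"
proof -
  obtain E M where "spectral_operator E M A"
    using assms by (rule scalar_type_spectral_obtains)
  then interpret spectral_operator E M A .
  show ?thesis
  proof
    assume "generates_beurling_carleman_semigroup (\<lambda>n. exp ((real n)\<^sup>2)) A"
    then obtain S where S: "C0_semigroup S" "generator S = A"
      and bc: "\<And>f. beurling_carleman_on (\<lambda>n. exp ((real n)\<^sup>2)) (\<lambda>t. S t f) {0<..}"
      unfolding generates_beurling_carleman_semigroup_def by blast
    have smooth: "infinitely_differentiable_on (\<lambda>t. S t f) {0<..}" for f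
      using bc by (simp add: beurling_carleman_on_def)
    have growth: "\<exists>C. \<forall>n. \<forall>z\<in>spectrum A. cmod z ^ n * exp (t * Re z) \<le> C * exp ((real n)\<^sup>2)"
      if t: "t > 0" for t
    proof -
      \<comment> \<open>A single time and \<open>\<alpha> = 1\<close> are enough.\<close>
      have "\<exists>c. \<forall>n. norm (nth_derivative n (\<lambda>t. S t f) t) \<le> c * exp ((real n)\<^sup>2)" for f
      proof -
        have "t \<le> t \<and> {t..t} \<subseteq> {0<..}" using t by simp
        then obtain c where "\<forall>n. \<forall>s\<in>{t..t}. norm (nth_derivative n (\<lambda>t. S t f) s) \<le> c * 1 ^ n * exp ((real n)\<^sup>2)"
          using bc[of f] unfolding beurling_carleman_on_def by (meson zero_less_one)
        then show ?thesis by auto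
      qed
      then obtain C where "\<And>n z. z \<in> spectrum A \<Longrightarrow> cmod z ^ n * exp (t * Re z) \<le> C * exp ((real n)\<^sup>2)"
        using spectrum_growth[OF S smooth t, of "\<lambda>n. exp ((real n)\<^sup>2)"] by auto
      then show ?thesis by blast
    qed
    show "\<forall>b>0. \<exists>a::real. \<forall>z\<in>spectrum A. Re z \<le> a - b * L \<bar>Im z\<bar>"
      using Re_le_of_power_exp_growth[OF _ growth] by blast
  next
    assume H: "\<forall>b>0. \<exists>a::real. \<forall>z\<in>spectrum A. Re z \<le> a - b * L \<bar>Im z\<bar>"
    obtain a where a: "\<And>z. z \<in> spectrum A \<Longrightarrow> Re z \<le> a - 1 * L \<bar>Im z\<bar>"
      using H zero_less_one by blast
    have Re_le: "Re z \<le> \<bar>a\<bar>" if "z \<in> spectrum A" for z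
    proof -
      have "0 \<le> L \<bar>Im z\<bar>" by (simp add: L_def)
      then show ?thesis using a[OF that] by linarith
    qed
    have "beurling_carleman_on (\<lambda>n. exp ((real n)\<^sup>2)) (\<lambda>t. exp_semigroup t f) {0<..}" for f
    proof (rule beurling_carleman_exp_semigroup)
      fix p q \<alpha> :: real assume p: "0 < p" and \<alpha>: "0 < \<alpha>"
      obtain C where "C > 0" "\<And>n t z. t \<in> {p..q} \<Longrightarrow> z \<in> spectrum A \<Longrightarrow>
          cmod z ^ n * exp (t * Re z) \<le> C * \<alpha> ^ n * exp ((real n)\<^sup>2)"
        using power_exp_spectral_growth[of "spectrum A" p \<alpha> q] H p \<alpha> by blast
      then show "\<exists>C>0. \<forall>n. \<forall>t\<in>{p..q}. \<forall>z\<in>spectrum A.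
          cmod z ^ n * exp (t * Re z) \<le> C * \<alpha> ^ n * exp ((real n)\<^sup>2)" by blast
    qed simp
    moreover have "C0_semigroup exp_semigroup" "generator exp_semigroup = A"
      using C0_exp_semigroup[OF _ Re_le] generator_exp_semigroup[OF _ Re_le] by simp_all
    ultimately show "generates_beurling_carleman_semigroup (\<lambda>n. exp ((real n)\<^sup>2)) A"
      unfolding generates_beurling_carleman_semigroup_def by blast
  qed
qed

end
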